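(* Let $\mathfrak{h}$ be a finite-dimensional complex Lie algebra and let $\theta\colon\mathfrak{sl}_2(\mathbb{C})\to\mathfrak{gl}(V)$ be a finite-dimensional Lie representation with $V\neq 0$. Then $\mathcal{F}(\mathcal{C}^\bullet\mathfrak{h},\mathfrak{sl}_2)_{(0)}$ equals $\{0\}$ when $H^1(\mathfrak{h})=0$, and otherwise equals the germ at $0$ of $\{\eta\otimes g:\eta\in H^1(\mathfrak{h}),\ g\in\mathfrak{sl}_2\}$ (which is isomorphic to the germ at $0$ of the cone on $\mathbb{P}(H^1(\mathfrak{h}))\times\mathbb{P}(\mathfrak{sl}_2)$). In the first case, for each $i$, $\mathcal{R}^i_1(\mathcal{C}^\bullet\mathfrak{h},\theta)_{(0)}$ is empty if $H^i(\mathfrak{h})=0$ and equals $\{0\}$ otherwise. In the second case, for each $i$, $\mathcal{R}^i_1(\mathcal{C}^\bullet\mathfrak{h},\theta)_{(0)}$ is empty if $H^i(\mathfrak{h})=0$, and otherwise equals the germ at $0$ of $\{\eta\otimes g:\eta\in H^1(\mathfrak{h}),\ g\in\mathfrak{sl}_2,\ \det\theta(g)=0\}$ (the cone on $\mathbb{P}(H^1(\mathfrak{h}))\times\mathbb{P}(V(\det\circ\theta))$).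
   Context: $\mathcal{C}^\bullet\mathfrak{h}=(\bigwedge^\bullet\mathfrak{h}^*,d)$ is the Chevalley–Eilenberg cochain cdga of $\mathfrak{h}$ (with $d\xi(x,y)=-\xi([x,y])$ for $\xi\in\mathfrak{h}^*$, extended as a derivation), and $H^\bullet(\mathfrak{h})$ is its cohomology; $H^1(\mathfrak{h})=\{\eta\in\mathfrak{h}^*: d\eta=0\}$. For a finite-dimensional Lie algebra $\mathfrak{g}$, $\mathcal{F}(A,\mathfrak{g})=\{\omega\in A^1\otimes\mathfrak{g}: d\omega+\frac12[\omega,\omega]=0\}$ (for $\omega=\sum_k\eta_k\otimes g_k$: $\sum_k d\eta_k\otimes g_k+\sum_{k<l}\eta_k\eta_l\otimes[g_k,g_l]=0$). For $\omega\in\mathcal{F}(A,\mathfrak{g})$ and $\theta\colon\mathfrak{g}\to\mathfrak{gl}(V)$, $d_\omega(a\otimes v)=da\otimes v+\sum_k\eta_ka\otimes\theta(g_k)v$ on $A^\bullet\otimes V$, and $\mathcal{R}^i_1(A,\theta)=\{\omega\in\mathcal{F}(A,\mathfrak{g}):H^i(A\otimes V,d_\omega)\neq 0\}$. $V(\det\circ\theta)\subseteq\mathfrak{sl}_2$ is the zero set of $g\mapsto\det\theta(g)$. $X_{(x)}$ denotes the analytic germ of $X$ at $x$. *)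

theory Defs
  imports "HOL-Analysis.Analysis"
begin

text \<open>Conventions. The finite-dimensional complex Lie algebra h is an abstract complex vector
space (type 'h, scalar multiplication sc, finite basis B) with a bracket br.
Cochains of degree k with values in a coefficient space 'w (scalar multiplication sw) are
functions on lists of length k, multilinear and alternating, and zero on lists of other
lengths; so A^k tensor W is identified with alternating k-linear maps h^k to W.
The wedge product uses the unnormalised (shuffle) convention, matching d xi (x,y) = - xi([x,y]).\<close>

definition lie_algebra :: "(complex \<Rightarrow> 'h \<Rightarrow> 'h) \<Rightarrow> ('h \<Rightarrow> 'h \<Rightarrow> 'h::ab_group_add) \<Rightarrow> bool" where
  "lie_algebra sc br \<longleftrightarrow> vector_space sc \<and>
     (\<forall>x. Vector_Spaces.linear sc sc (br x)) \<and>
     (\<forall>y. Vector_Spaces.linear sc sc (\<lambda>x. br x y)) \<and>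
     (\<forall>x. br x x = 0) \<and>
     (\<forall>x y z. br x (br y z) + br y (br z x) + br z (br x y) = 0)"

text \<open>Scalar multiplication on matrices.\<close>
definition mscale :: "'a::times \<Rightarrow> 'a^'n^'m \<Rightarrow> 'a^'n^'m" where
  "mscale c M = (\<chi> i j. c * M $ i $ j)"

definition sl2 :: "(complex^2^2) set" where
  "sl2 = {g. trace g = 0}"

text \<open>A finite-dimensional Lie representation theta : sl2 -> gl(V), V = complex^'m (nonzero).\<close>
definition sl2_rep :: "(complex^2^2 \<Rightarrow> complex^'m^'m) \<Rightarrow> bool" where
  "sl2_rep \<theta> \<longleftrightarrow>
     (\<forall>a\<in>sl2. \<forall>b\<in>sl2. \<theta> (a + b) = \<theta> a + \<theta> b) \<and>
     (\<forall>c. \<forall>a\<in>sl2. \<theta> (mscale c a) = mscale c (\<theta> a)) \<and>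
     (\<forall>a\<in>sl2. \<forall>b\<in>sl2. \<theta> (a ** b - b ** a) = \<theta> a ** \<theta> b - \<theta> b ** \<theta> a)"

definition cochain :: "(complex \<Rightarrow> 'h::ab_group_add \<Rightarrow> 'h) \<Rightarrow> (complex \<Rightarrow> 'w \<Rightarrow> 'w) \<Rightarrow> nat
    \<Rightarrow> ('h list \<Rightarrow> 'w::ab_group_add) \<Rightarrow> bool" where
  "cochain sc sw k \<phi> \<longleftrightarrow>
     (\<forall>xs. length xs \<noteq> k \<longrightarrow> \<phi> xs = 0) \<and>
     (\<forall>xs i. length xs = k \<and> i < k \<longrightarrow> Vector_Spaces.linear sc sw (\<lambda>x. \<phi> (xs[i := x]))) \<and>
     (\<forall>xs i j. length xs = k \<and> i < j \<and> j < k \<and> xs ! i = xs ! j \<longrightarrow> \<phi> xs = 0)"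

text \<open>Chevalley--Eilenberg differential with coefficients in 'w via the action rho:
 (d phi)(x_0..x_k) = sum_{i<j} (-1)^(i+j) phi([x_i,x_j], x_0..^i..^j..x_k)
                   + sum_i (-1)^i rho(x_i) phi(x_0..^i..x_k).
 With rho = 0 this is the differential of C^*(h) (tensor W); with rho x = theta(omega x)
 it is d_omega (since (eta wedge a)(x_0..x_k) = sum_i (-1)^i eta(x_i) a(..^i..)).\<close>
definition ce_d :: "(complex \<Rightarrow> 'w \<Rightarrow> 'w) \<Rightarrow> ('h \<Rightarrow> 'h \<Rightarrow> 'h) \<Rightarrow> ('h \<Rightarrow> 'w \<Rightarrow> 'w)
    \<Rightarrow> ('h list \<Rightarrow> 'w::ab_group_add) \<Rightarrow> 'h list \<Rightarrow> 'w" where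
  "ce_d sw br \<rho> \<phi> xs =
     (\<Sum>j<length xs. \<Sum>i<j. sw ((-1) ^ (i + j)) (\<phi> (br (xs ! i) (xs ! j) # nths xs (- {i, j}))))
     + (\<Sum>i<length xs. sw ((-1) ^ i) (\<rho> (xs ! i) (\<phi> (nths xs (- {i})))))"

text \<open>H^i of the complex is nonzero: some i-cocycle is not an i-coboundary.\<close>
definition ce_H_nonzero :: "(complex \<Rightarrow> 'h::ab_group_add \<Rightarrow> 'h) \<Rightarrow> (complex \<Rightarrow> 'w::ab_group_add \<Rightarrow> 'w) \<Rightarrow> ('h \<Rightarrow> 'h \<Rightarrow> 'h)
    \<Rightarrow> ('h \<Rightarrow> 'w \<Rightarrow> 'w) \<Rightarrow> nat \<Rightarrow> bool" where
  "ce_H_nonzero sc sw br \<rho> i \<longleftrightarrow>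
     (\<exists>\<phi>::'h list \<Rightarrow> 'w. cochain sc sw i \<phi> \<and> ce_d sw br \<rho> \<phi> = (\<lambda>_. 0) \<and>
        \<phi> \<noteq> (\<lambda>_. 0) \<and>
        \<not> (\<exists>\<psi>. 0 < i \<and> cochain sc sw (i - 1) \<psi> \<and> ce_d sw br \<rho> \<psi> = \<phi>))"

text \<open>H^i(h) with trivial complex coefficients.\<close>
definition lie_H_nonzero :: "(complex \<Rightarrow> 'h \<Rightarrow> 'h) \<Rightarrow> ('h \<Rightarrow> 'h \<Rightarrow> 'h::ab_group_add) \<Rightarrow> nat \<Rightarrow> bool" where
  "lie_H_nonzero sc br i \<longleftrightarrow> ce_H_nonzero sc ((*) :: complex \<Rightarrow> complex \<Rightarrow> complex) br (\<lambda>_ _. 0) i"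

definition one_cochain :: "('h \<Rightarrow> 'w) \<Rightarrow> 'h list \<Rightarrow> 'w::zero" where
  "one_cochain \<eta> xs = (case xs of [x] \<Rightarrow> \<eta> x | _ \<Rightarrow> 0)"

text \<open>H^1(h) = closed elements of h^*.\<close>
definition H1 :: "(complex \<Rightarrow> 'h \<Rightarrow> 'h) \<Rightarrow> ('h \<Rightarrow> 'h \<Rightarrow> 'h::ab_group_add) \<Rightarrow> ('h \<Rightarrow> complex) set" where
  "H1 sc br = {\<eta>. Vector_Spaces.linear sc (*) \<eta> \<and>
                  ce_d (*) br (\<lambda>_ _. 0) (one_cochain \<eta>) = (\<lambda>_. 0)}"

text \<open>A^1 tensor sl2 = linear maps h -> sl2.\<close>
definition hom_sl2 :: "(complex \<Rightarrow> 'h::ab_group_add \<Rightarrow> 'h) \<Rightarrow> ('h \<Rightarrow> complex^2^2) set" where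
  "hom_sl2 sc = {\<omega>. Vector_Spaces.linear sc mscale \<omega> \<and> (\<forall>x. \<omega> x \<in> sl2)}"

text \<open>(1/2)[omega,omega] = sum_{k<l} eta_k eta_l (x) [g_k,g_l], evaluated on (x,y).\<close>
definition mc_quad :: "('h \<Rightarrow> complex^2^2) \<Rightarrow> 'h list \<Rightarrow> complex^2^2" where
  "mc_quad \<omega> xs = (case xs of [x, y] \<Rightarrow> \<omega> x ** \<omega> y - \<omega> y ** \<omega> x | _ \<Rightarrow> 0)"

text \<open>F(C^*h, sl2): Maurer--Cartan elements.\<close>
definition flat :: "(complex \<Rightarrow> 'h \<Rightarrow> 'h) \<Rightarrow> ('h \<Rightarrow> 'h \<Rightarrow> 'h::ab_group_add) \<Rightarrow> ('h \<Rightarrow> complex^2^2) set" where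
  "flat sc br = {\<omega> \<in> hom_sl2 sc.
     (\<lambda>xs. ce_d mscale br (\<lambda>_ _. 0) (one_cochain \<omega>) xs + mc_quad \<omega> xs) = (\<lambda>_. 0)}"

text \<open>R^i_1(C^*h, theta).\<close>
definition resonance :: "(complex \<Rightarrow> 'h \<Rightarrow> 'h) \<Rightarrow> ('h \<Rightarrow> 'h \<Rightarrow> 'h::ab_group_add)
    \<Rightarrow> (complex^2^2 \<Rightarrow> complex^'m^'m) \<Rightarrow> nat \<Rightarrow> ('h \<Rightarrow> complex^2^2) set" where
  "resonance sc br \<theta> i = {\<omega> \<in> flat sc br.
     ce_H_nonzero sc ((*s) :: complex \<Rightarrow> complex^'m \<Rightarrow> complex^'m) br (\<lambda>x v. \<theta> (\<omega> x) *v v) i}"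

definition decomposables :: "(complex \<Rightarrow> 'h \<Rightarrow> 'h) \<Rightarrow> ('h \<Rightarrow> 'h \<Rightarrow> 'h::ab_group_add)
    \<Rightarrow> ('h \<Rightarrow> complex^2^2) set" where
  "decomposables sc br = {\<omega>. \<exists>\<eta>\<in>H1 sc br. \<exists>g\<in>sl2. \<omega> = (\<lambda>x. mscale (\<eta> x) g)}"

definition decomposables_det :: "(complex \<Rightarrow> 'h \<Rightarrow> 'h) \<Rightarrow> ('h \<Rightarrow> 'h \<Rightarrow> 'h::ab_group_add)
    \<Rightarrow> (complex^2^2 \<Rightarrow> complex^'m^'m) \<Rightarrow> ('h \<Rightarrow> complex^2^2) set" where
  "decomposables_det sc br \<theta> =
     {\<omega>. \<exists>\<eta>\<in>H1 sc br. \<exists>g\<in>sl2. det (\<theta> g) = 0 \<and> \<omega> = (\<lambda>x. mscale (\<eta> x) g)}"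

text \<open>Equality of analytic germs at 0 of subsets X, Y of the ambient space A of linear maps
h -> sl2, topologised via the values on the basis B.\<close>
definition germ0_eq :: "'h set \<Rightarrow> ('h \<Rightarrow> 'a::real_normed_vector) set \<Rightarrow> ('h \<Rightarrow> 'a) set
    \<Rightarrow> ('h \<Rightarrow> 'a) set \<Rightarrow> bool" where
  "germ0_eq B A X Y \<longleftrightarrow> (\<exists>\<epsilon>>0. \<forall>\<omega>\<in>A. (\<forall>b\<in>B. norm (\<omega> b) < \<epsilon>) \<longrightarrow> (\<omega> \<in> X \<longleftrightarrow> \<omega> \<in> Y))"

end

theory Submission
  imports Defs
begin

text \<open>For a flat connection \<open>\<omega>\<close> the Lie derivative \<open>L\<^sub>x\<close> on twisted cochains is null-homotopic, and it is
the untwisted Lie derivative plus \<open>\<theta>(\<omega>(x))\<close>. The untwisted one is annihilated by a nonzero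
polynomial that does not depend on \<open>\<omega>\<close>, so twisted cohomology can only live on eigenvalues of
\<open>\<theta>(\<omega>(x))\<close> that are roots of that polynomial up to sign. For \<open>\<omega>\<close> close to 0 this leaves the eigenvalue 0.
Applied to \<open>\<omega>\<close> itself (a map into \<open>sl\<^sub>2\<close>), the same argument forces \<open>det \<omega>(b + b') = 0\<close> for basis
vectors \<open>b, b'\<close> unless \<open>\<omega>(b + b')\<close> commutes with the image; so the image is either centralised by a
nonzero element or isotropic for the Killing form, and in both cases it is at most a line, that is \<open>\<omega> = \<eta> \<otimes> g\<close>.
For such \<open>\<omega>\<close> the twisted complex depends only on the single matrix \<open>M = \<theta>(g)\<close>; its cohomology vanishes on the
part where \<open>M\<close> is invertible, and on the nilpotent part it vanishes exactly when the untwisted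
cohomology does.\<close>

section \<open>Cartan calculus for Chevalley--Eilenberg cochains\<close>

text \<open>No eigenvalue is ever computed. The annihilating polynomial is written as t^l q(t) with
  q(0) \<noteq> 0. For a small matrix A the value q(A) is invertible by continuity of the
  determinant, so exactness of q(A) A^l \<phi> yields exactness of A^l \<phi>. For a given degree
  one such polynomial is fixed for each basis vector (and, in degree 1, for each sum of two basis
  vectors) before \<omega> is chosen; the basis being finite, one radius serves them all. Sums of
  two basis vectors are needed because det is quadratic on sl2: by polarisation these sums determine
  it. For \<omega> = \<eta> \<otimes> g the matrix M = \<theta>(g) itself need not be small, only
  the values \<theta>(\<omega>(b)) = \<eta>(b) M are. Passing from A = - \<eta>(b) M to M costs a
  nonzero scalar, so what survives is that a power of M kills the twisted cohomology. The rest of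
  the argument for such \<omega> is linear algebra in M, valid at every scale.\<close>

lemma linear_zero: "Vector_Spaces.linear sa sb f \<Longrightarrow> f 0 = 0"
  unfolding linear_iff_module_hom by (rule module_hom.zero)

lemma linear_diff: "Vector_Spaces.linear sa sb f \<Longrightarrow> f (x - y) = f x - f y"
  unfolding linear_iff_module_hom by (rule module_hom.diff)

lemma linear_minus: "Vector_Spaces.linear sa sb f \<Longrightarrow> f (- x) = - f x"
  unfolding linear_iff_module_hom by (rule module_hom.neg)

lemma vector_space_scale_zero: "vector_space sw \<Longrightarrow> sw c 0 = 0"
  unfolding module_iff_vector_space[symmetric] by (rule module.scale_zero_right)

text \<open>Cartan's formula \<open>\<iota>\<^sub>x d + d \<iota>\<^sub>x = L\<^sub>x\<close> is used as a recursive definition of the differential;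
\<open>\<iota>\<^sub>x \<phi>\<close> is \<open>\<lambda>xs. \<phi> (x # xs)\<close>.\<close>

fun lie_der :: "('h \<Rightarrow> 'h \<Rightarrow> 'h) \<Rightarrow> ('h \<Rightarrow> 'w \<Rightarrow> 'w) \<Rightarrow> 'h \<Rightarrow> ('h list \<Rightarrow> 'w::ab_group_add) \<Rightarrow> 'h list \<Rightarrow> 'w" where
  "lie_der br \<rho> x \<phi> [] = \<rho> x (\<phi> [])"
| "lie_der br \<rho> x \<phi> (y # ys) = lie_der br \<rho> x (\<lambda>zs. \<phi> (y # zs)) ys - \<phi> (br x y # ys)"

fun cdiff :: "('h \<Rightarrow> 'h \<Rightarrow> 'h) \<Rightarrow> ('h \<Rightarrow> 'w \<Rightarrow> 'w) \<Rightarrow> ('h list \<Rightarrow> 'w::ab_group_add) \<Rightarrow> 'h list \<Rightarrow> 'w" where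
  "cdiff br \<rho> \<phi> [] = 0"
| "cdiff br \<rho> \<phi> (x # xs) = lie_der br \<rho> x \<phi> xs - cdiff br \<rho> (\<lambda>zs. \<phi> (x # zs)) xs"

text \<open>The recursion on the first argument matches that of \<open>cdiff\<close>, and
  contraction by a vector visibly lowers the degree. Asking for alternation only in the first two
  slots at each level suffices, since it yields antisymmetry under neighbour exchanges;
  \<open>cochain_iff_form\<close> gives the equivalence with \<open>cochain\<close>.\<close>

primrec form :: "(complex \<Rightarrow> 'h::ab_group_add \<Rightarrow> 'h) \<Rightarrow> (complex \<Rightarrow> 'w \<Rightarrow> 'w) \<Rightarrow> nat
    \<Rightarrow> ('h list \<Rightarrow> 'w::ab_group_add) \<Rightarrow> bool" where
  "form sc sw 0 \<phi> \<longleftrightarrow> (\<forall>x xs. \<phi> (x # xs) = 0)"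
| "form sc sw (Suc k) \<phi> \<longleftrightarrow> \<phi> [] = 0 \<and> (\<forall>xs. Vector_Spaces.linear sc sw (\<lambda>x. \<phi> (x # xs)))
     \<and> (\<forall>x xs. \<phi> (x # x # xs) = 0) \<and> (\<forall>x. form sc sw k (\<lambda>xs. \<phi> (x # xs)))"

lemma form_length: "form sc sw k \<phi> \<Longrightarrow> length xs \<noteq> k \<Longrightarrow> \<phi> xs = 0"
proof (induction k arbitrary: \<phi> xs)
  case 0
  then show ?case by (cases xs) auto
next
  case (Suc k)
  show ?case
  proof (cases xs)
    case Nil
    with Suc.prems show ?thesis by simp
  next
    case (Cons x ys)
    with Suc.prems Suc.IH[of "\<lambda>zs. \<phi> (x # zs)" ys] show ?thesis by simp
  qed
qed

lemma form_add1: "form sc sw k \<phi> \<Longrightarrow> \<phi> ((x + y) # xs) = \<phi> (x # xs) + \<phi> (y # xs)"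
  by (cases k) (auto simp: Vector_Spaces.linear_iff)

lemma form_zero1: "form sc sw k \<phi> \<Longrightarrow> \<phi> (0 # xs) = 0"
  by (cases k) (auto dest: linear_zero)

lemma form_diff1: "form sc sw k \<phi> \<Longrightarrow> \<phi> ((x - y) # xs) = \<phi> (x # xs) - \<phi> (y # xs)"
  using form_add1[of sc sw k \<phi> "x - y" y xs] by simp

lemma form_scale1:
  "form sc sw k \<phi> \<Longrightarrow> vector_space sw \<Longrightarrow> \<phi> (sc c x # xs) = sw c (\<phi> (x # xs))"
  by (cases k) (auto simp: Vector_Spaces.linear_iff vector_space_scale_zero)

text \<open>The truncated \<open>k - 1\<close> is deliberate: contracting a 0-form gives zero, which
  is again a 0-form. Inductions over the argument list therefore need no case split on the
  degree.\<close>

lemma form_tail: "form sc sw k \<phi> \<Longrightarrow> form sc sw (k - 1) (\<lambda>zs. \<phi> (x # zs))"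
  by (cases k) auto

lemma form_add2:
  "form sc sw k \<phi> \<Longrightarrow> \<phi> (z # (x + y) # xs) = \<phi> (z # x # xs) + \<phi> (z # y # xs)"
  using form_add1[OF form_tail] .

lemma form_alt: "form sc sw k \<phi> \<Longrightarrow> \<phi> (x # x # xs) = 0"
  by (cases k) auto

lemma form_swap: assumes "form sc sw k \<phi>" shows "\<phi> (y # x # xs) = - \<phi> (x # y # xs)"
proof -
  have "\<phi> ((x + y) # (x + y) # xs) = 0" using form_alt[OF assms] .
  then have "\<phi> (x # y # xs) + \<phi> (y # x # xs) = 0"
    unfolding form_add1[OF assms] form_add2[OF assms] by (simp add: form_alt[OF assms] add.commute)
  then show ?thesis by (simp add: eq_neg_iff_add_eq_0 add.commute)
qed

lemma form_linear_slot:
  "form sc sw k \<phi> \<Longrightarrow> length xs = k \<Longrightarrow> i < k \<Longrightarrow> Vector_Spaces.linear sc sw (\<lambda>x. \<phi> (xs[i := x]))"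
proof (induction k arbitrary: \<phi> xs i)
  case (Suc k)
  then obtain y ys where xs: "xs = y # ys" "length ys = k" by (cases xs) auto
  show ?case
  proof (cases i)
    case 0
    with Suc.prems xs show ?thesis by simp
  next
    case (Suc j)
    have "Vector_Spaces.linear sc sw (\<lambda>x. (\<lambda>zs. \<phi> (y # zs)) (ys[j := x]))"
      using Suc.IH[of "\<lambda>zs. \<phi> (y # zs)" ys j] Suc.prems Suc xs by simp
    then show ?thesis using xs Suc by simp
  qed
qed simp

lemma form_alternating:
  "form sc sw k \<phi> \<Longrightarrow> length xs = k \<Longrightarrow> i < j \<Longrightarrow> j < k \<Longrightarrow> xs ! i = xs ! j \<Longrightarrow> \<phi> xs = 0"
proof (induction k arbitrary: \<phi> xs i j)
  case (Suc k)
  then obtain x ys where xs: "xs = x # ys" "length ys = k" by (cases xs) auto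
  obtain j' where j: "j = Suc j'" using Suc.prems by (cases j) auto
  have IH: "\<phi> (z # zs) = 0" if "length zs = k" "a < b" "b < k" "zs ! a = zs ! b" for z zs a b
    using Suc.IH[of "\<lambda>zs. \<phi> (z # zs)" zs a b] Suc.prems(1) that by simp
  show ?case
  proof (cases i)
    case (Suc i')
    then show ?thesis using IH[of ys i' j' x] Suc.prems xs j by simp
  next
    case 0
    obtain y zs where ys: "ys = y # zs" using xs j Suc.prems by (cases ys) auto
    show ?thesis
    proof (cases j')
      case 0
      with \<open>i = 0\<close> j xs ys Suc.prems have "x = y" by simp
      then show ?thesis using xs ys form_alt[OF Suc.prems(1)] by simp
    next
      case (Suc j'')
      \<comment> \<open>Exchanging the first two entries moves both equal arguments into the tail,
        where the induction hypothesis applies.\<close>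
      have "\<phi> (y # x # zs) = 0"
        using IH[of "x # zs" 0 "j'" y] xs ys Suc j \<open>i = 0\<close> Suc.prems by simp
      then show ?thesis using form_swap[OF Suc.prems(1), of x y zs] xs ys by simp
    qed
  qed
qed simp

lemma cochain_tail:
  assumes "cochain sc sw (Suc k) \<phi>" shows "cochain sc sw k (\<lambda>zs. \<phi> (x # zs))"
  unfolding cochain_def
proof (intro conjI allI impI)
  fix xs :: "'a list" assume "length xs \<noteq> k"
  then show "\<phi> (x # xs) = 0" using assms unfolding cochain_def by simp
next
  fix xs :: "'a list" and i assume *: "length xs = k \<and> i < k"
  have "Vector_Spaces.linear sc sw (\<lambda>y. \<phi> ((x # xs)[Suc i := y]))"
    using assms * unfolding cochain_def by (metis Suc_less_eq length_Cons)
  then show "Vector_Spaces.linear sc sw (\<lambda>y. \<phi> (x # xs[i := y]))" by simp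
next
  fix xs :: "'a list" and i j assume *: "length xs = k \<and> i < j \<and> j < k \<and> xs ! i = xs ! j"
  have "length (x # xs) = Suc k \<and> Suc i < Suc j \<and> Suc j < Suc k \<and> (x # xs) ! Suc i = (x # xs) ! Suc j"
    using * by simp
  then show "\<phi> (x # xs) = 0" using assms unfolding cochain_def by blast
qed

lemma cochain_imp_form:
  assumes "vector_space sc" "vector_space sw"
  shows "cochain sc sw k \<phi> \<Longrightarrow> form sc sw k \<phi>"
proof (induction k arbitrary: \<phi>)
  case 0
  then show ?case by (simp add: cochain_def)
next
  case (Suc k)
  have c: "length xs \<noteq> Suc k \<Longrightarrow> \<phi> xs = 0" for xs
    using Suc.prems unfolding cochain_def by blast
  have lin: "Vector_Spaces.linear sc sw (\<lambda>x. \<phi> (x # xs))" for xs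
  proof (cases "length xs = k")
    case True
    have "Vector_Spaces.linear sc sw (\<lambda>x. \<phi> ((0 # xs)[0 := x]))"
      using Suc.prems True unfolding cochain_def by (metis length_Cons zero_less_Suc)
    then show ?thesis by simp
  next
    case False
    then have "\<phi> (x # xs) = 0" for x using c by simp
    then show ?thesis using assms by (simp add: Vector_Spaces.linear_iff vector_space_scale_zero)
  qed
  have alt: "\<phi> (x # x # xs) = 0" for x xs
  proof (cases "length (x # x # xs) = Suc k")
    case True
    then have "length (x # x # xs) = Suc k \<and> 0 < Suc 0 \<and> Suc 0 < Suc k \<and> (x # x # xs) ! 0 = (x # x # xs) ! Suc 0"
      by auto
    then show ?thesis using Suc.prems unfolding cochain_def by blast
  qed (use c in blast)
  show ?case using c[of "[]"] lin alt Suc.IH[OF cochain_tail[OF Suc.prems]] by simp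
qed

lemma cochain_iff_form:
  assumes "vector_space sc" "vector_space sw"
  shows "cochain sc sw k \<phi> \<longleftrightarrow> form sc sw k \<phi>"
proof
  assume f: "form sc sw k \<phi>"
  show "cochain sc sw k \<phi>" unfolding cochain_def
    using form_length[OF f] form_linear_slot[OF f] form_alternating[OF f] by blast
qed (rule cochain_imp_form[OF assms])

lemma form_zero: "vector_space sc \<Longrightarrow> vector_space sw \<Longrightarrow> form sc sw k (\<lambda>_. 0)"
  by (induction k) (auto simp: Vector_Spaces.linear_iff vector_space_scale_zero)

lemma form_lin_comp:
  assumes "Vector_Spaces.linear sw sw' f"
  shows "form sc sw k \<phi> \<Longrightarrow> form sc sw' k (\<lambda>xs. f (\<phi> xs))"
proof (induction k arbitrary: \<phi>)
  case 0
  then show ?case using linear_zero[OF assms] by simp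
next
  case (Suc k)
  then show ?case using assms linear_zero[OF assms] by (auto simp: Vector_Spaces.linear_iff)
qed

lemma form_add: "form sc sw k \<phi> \<Longrightarrow> form sc sw k \<psi> \<Longrightarrow> form sc sw k (\<lambda>xs. \<phi> xs + \<psi> xs)"
proof (induction k arbitrary: \<phi> \<psi>)
  case (Suc k)
  have "Vector_Spaces.linear sc sw (\<lambda>x. \<phi> (x # xs) + \<psi> (x # xs))" for xs
    using Suc.prems by (auto simp: Vector_Spaces.linear_iff module.scale_right_distrib simp flip: module_iff_vector_space)
  then show ?case using Suc by simp
qed simp

lemma linear_scaleI: "vector_space sw \<Longrightarrow> Vector_Spaces.linear sw sw (sw c)"
  unfolding Vector_Spaces.linear_iff
  by (simp add: module.scale_right_distrib module.scale_scale mult.commute flip: module_iff_vector_space)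

lemma form_scale: "vector_space sw \<Longrightarrow> form sc sw k \<phi> \<Longrightarrow> form sc sw k (\<lambda>xs. sw c (\<phi> xs))"
  by (rule form_lin_comp[OF linear_scaleI])

lemma vector_space_scale_minus_one: "vector_space sw \<Longrightarrow> sw (-1) v = - v"
  by (simp add: module.scale_minus_left module.scale_one flip: module_iff_vector_space)

lemma form_minus: "vector_space sw \<Longrightarrow> form sc sw k \<phi> \<Longrightarrow> form sc sw k (\<lambda>xs. - \<phi> xs)"
  using form_scale[of sw sc k \<phi> "-1"] by (simp add: vector_space_scale_minus_one)

lemma form_diff:
  "vector_space sw \<Longrightarrow> form sc sw k \<phi> \<Longrightarrow> form sc sw k \<psi> \<Longrightarrow> form sc sw k (\<lambda>xs. \<phi> xs - \<psi> xs)"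
  using form_add[of sc sw k \<phi> "\<lambda>xs. - \<psi> xs"] form_minus[of sw sc k \<psi>] by simp

section \<open>Comparison of \<open>ce_d\<close> with the recursive differential\<close>

lemma lie_der_eq_sum:
  "lie_der br \<rho> x \<phi> xs = \<rho> x (\<phi> xs) - (\<Sum>j<length xs. \<phi> (xs[j := br x (xs ! j)]))"
proof (induction xs arbitrary: \<phi>)
  case (Cons y ys)
  show ?case by (simp only: lie_der.simps Cons.IH length_Cons sum.lessThan_Suc_shift) simp
qed simp

text \<open>Carrying \<open>y\<close> from the front to slot \<open>j\<close> takes \<open>j\<close>
  neighbour exchanges, each with one sign.\<close>

lemma form_move:
  "vector_space sw \<Longrightarrow> form sc sw k \<phi> \<Longrightarrow> j < length xs \<Longrightarrow>
    \<phi> (y # nths xs (- {j})) = sw ((-1) ^ j) (\<phi> (xs[j := y]))"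
proof (induction xs arbitrary: \<phi> j k)
  case (Cons z zs)
  interpret vector_space sw by fact
  show ?case
  proof (cases j)
    case 0
    have "{j. Suc j \<in> - {0}} = UNIV" by auto
    then show ?thesis using 0 by (simp add: nths_Cons nths_all)
  next
    case (Suc i)
    have "{j. Suc j \<in> - {Suc i}} = - {i}" by auto
    then have "\<phi> (y # nths (z # zs) (- {j})) = - \<phi> (z # y # nths zs (- {i}))"
      using Suc form_swap[OF Cons.prems(2), of y z] by (simp add: nths_Cons)
    also have "\<dots> = - sw ((-1) ^ i) (\<phi> (z # zs[i := y]))"
      using Cons.IH[OF Cons.prems(1) form_tail[OF Cons.prems(2)], of i] Suc Cons.prems by simp
    finally show ?thesis using Suc by simp
  qed
qed simp

text \<open>The terms that delete index 0 add up to the Lie derivative along \<open>x\<close>. In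
  all others \<open>x\<close> survives: a bracket term changes sign because \<open>x\<close> is
  moved in front of the bracket, an action term because its index drops by one.\<close>

lemma ce_d_Cons:
  assumes "vector_space sw" "form sc sw k \<phi>"
  shows "ce_d sw br \<rho> \<phi> (x # xs) = lie_der br \<rho> x \<phi> xs - ce_d sw br \<rho> (\<lambda>zs. \<phi> (x # zs)) xs"
proof -
  interpret vector_space sw by fact
  have s1: "{j. j \<noteq> i} = - {i}" for i :: nat by auto
  have s2: "{j. j \<noteq> a \<and> j \<noteq> b} = - {a, b}" for a b :: nat by auto
  have n0: "nths (x # xs) (- {0}) = xs" by (simp add: nths_Cons nths_all)
  have n1: "nths (x # xs) (- {Suc i}) = x # nths xs (- {i})" for i by (simp add: nths_Cons s1)
  have n2: "nths (x # xs) (- {0, Suc i}) = nths xs (- {i})" for i by (simp add: nths_Cons s1)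
  have n3: "nths (x # xs) (- {Suc a, Suc b}) = x # nths xs (- {a, b})" for a b
    by (simp add: nths_Cons s2)
  have m: "sw ((-1) ^ Suc j) (\<phi> (y # nths xs (- {j}))) = - \<phi> (xs[j := y])" if "j < length xs" for j y
    unfolding form_move[OF assms that] by (simp flip: power_add mult_2)
  have "ce_d sw br \<rho> \<phi> (x # xs) =
      (\<Sum>j<length xs. sw ((-1) ^ Suc j) (\<phi> (br x (xs ! j) # nths xs (- {j})))
         + (\<Sum>i<j. sw ((-1) ^ (i + j)) (\<phi> (br (xs ! i) (xs ! j) # x # nths xs (- {i, j})))))
    + (\<rho> x (\<phi> xs) + (\<Sum>i<length xs. sw ((-1) ^ Suc i) (\<rho> (xs ! i) (\<phi> (x # nths xs (- {i}))))))"
    unfolding ce_d_def length_Cons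
    by (simp only: sum.lessThan_Suc_shift lessThan_0 sum.empty n0 n1 n2 n3 nth_Cons_0 nth_Cons_Suc
        add_Suc add_Suc_right add_0 power_0 scale_one power_Suc mult_minus1 minus_minus)
  also have "\<dots> = (\<Sum>j<length xs. - \<phi> (xs[j := br x (xs ! j)])
         + (\<Sum>i<j. - sw ((-1) ^ (i + j)) (\<phi> (x # br (xs ! i) (xs ! j) # nths xs (- {i, j})))))
    + (\<rho> x (\<phi> xs) - (\<Sum>i<length xs. sw ((-1) ^ i) (\<rho> (xs ! i) (\<phi> (x # nths xs (- {i}))))))"
  proof -
    have "(\<Sum>j<length xs. sw ((-1) ^ Suc j) (\<phi> (br x (xs ! j) # nths xs (- {j})))
         + (\<Sum>i<j. sw ((-1) ^ (i + j)) (\<phi> (br (xs ! i) (xs ! j) # x # nths xs (- {i, j}))))) =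
       (\<Sum>j<length xs. - \<phi> (xs[j := br x (xs ! j)])
         + (\<Sum>i<j. - sw ((-1) ^ (i + j)) (\<phi> (x # br (xs ! i) (xs ! j) # nths xs (- {i, j})))))"
      by (rule sum.cong[OF refl]) (simp only: m form_swap[OF assms(2), of _ x] lessThan_iff scale_minus_right)
    then show ?thesis by (simp add: sum_negf)
  qed
  also have "\<dots> = lie_der br \<rho> x \<phi> xs - ce_d sw br \<rho> (\<lambda>zs. \<phi> (x # zs)) xs"
    unfolding lie_der_eq_sum ce_d_def by (simp add: sum_subtractf sum_negf)
  finally show ?thesis .
qed

lemma ce_d_eq_cdiff:
  assumes "vector_space sw"
  shows "form sc sw k \<phi> \<Longrightarrow> ce_d sw br \<rho> \<phi> xs = cdiff br \<rho> \<phi> xs"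
proof (induction xs arbitrary: k \<phi>)
  case Nil
  show ?case by (simp add: ce_d_def)
next
  case (Cons x xs)
  show ?case unfolding ce_d_Cons[OF assms Cons.prems] cdiff.simps
    using Cons.IH[OF form_tail[OF Cons.prems]] by simp
qed

section \<open>Commutation rules for the Lie derivative and the differential\<close>

locale lie_module =
  fixes sc :: "complex \<Rightarrow> 'h::ab_group_add \<Rightarrow> 'h" and br :: "'h \<Rightarrow> 'h \<Rightarrow> 'h"
    and sw :: "complex \<Rightarrow> 'w::ab_group_add \<Rightarrow> 'w" and \<rho> :: "'h \<Rightarrow> 'w \<Rightarrow> 'w"
  assumes lie: "lie_algebra sc br"
    and linear_act: "Vector_Spaces.linear sw sw (\<rho> x)"
    and linear_rep: "Vector_Spaces.linear sc sw (\<lambda>x. \<rho> x v)"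
    and rep: "\<rho> (br x y) v = \<rho> x (\<rho> y v) - \<rho> y (\<rho> x v)"
begin

abbreviation "L \<equiv> lie_der br \<rho>"
abbreviation "D \<equiv> cdiff br \<rho>"
abbreviation "Form \<equiv> form sc sw"

lemma vs_h: "vector_space sc" and vs_w: "vector_space sw"
  using lie linear_act by (auto simp: lie_algebra_def Vector_Spaces.linear_iff)

lemma linear_br_right: "Vector_Spaces.linear sc sc (br x)"
  and linear_br_left: "Vector_Spaces.linear sc sc (\<lambda>x. br x y)"
  and br_self: "br x x = 0"
  and jacobi: "br x (br y z) + br y (br z x) + br z (br x y) = 0"
  using lie by (auto simp: lie_algebra_def)

lemma br_add_right: "br x (y + z) = br x y + br x z"
  and br_add_left: "br (x + y) z = br x z + br y z"
  and br_scale_right: "br x (sc c z) = sc c (br x z)"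
  and br_scale_left: "br (sc c x) z = sc c (br x z)"
  using linear_br_right linear_br_left by (auto simp: Vector_Spaces.linear_iff)

lemma br_swap: "br y x = - br x y"
  using br_self[of "x + y"] unfolding br_add_left br_add_right
  by (simp add: br_self eq_neg_iff_add_eq_0 add.commute)

lemma br_br: "br (br x y) z = br x (br y z) - br y (br x z)"
  using jacobi[of x y z] br_swap[of "br x y" z] br_swap[of z x] linear_minus[OF linear_br_right, of y "br x z"]
  by (simp add: algebra_simps)

lemma act_add: "\<rho> x (v + w) = \<rho> x v + \<rho> x w"
  and act_scale: "\<rho> x (sw c v) = sw c (\<rho> x v)"
  and rep_add: "\<rho> (x + y) v = \<rho> x v + \<rho> y v"
  and rep_scale: "\<rho> (sc c x) v = sw c (\<rho> x v)"
  using linear_act linear_rep by (auto simp: Vector_Spaces.linear_iff)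

lemma act_zero: "\<rho> x 0 = 0"
  using linear_zero[OF linear_act] .

lemma act_diff: "\<rho> x (v - w) = \<rho> x v - \<rho> x w"
  using linear_diff[OF linear_act] .

lemma L_zero [simp]: "L x (\<lambda>_. 0) = (\<lambda>_. 0)"
proof
  show "L x (\<lambda>_. 0) xs = 0" for xs by (induction xs) (simp_all add: act_zero)
qed

lemma D_zero [simp]: "D (\<lambda>_. 0) = (\<lambda>_. 0)"
proof
  show "D (\<lambda>_. 0) xs = 0" for xs by (induction xs) simp_all
qed

lemma L_diff: "L x (\<lambda>xs. \<phi> xs - \<psi> xs) xs = L x \<phi> xs - L x \<psi> xs"
  by (induction xs arbitrary: \<phi> \<psi>) (simp_all add: act_diff)

lemma L_add: "L x (\<lambda>xs. \<phi> xs + \<psi> xs) xs = L x \<phi> xs + L x \<psi> xs"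
  by (induction xs arbitrary: \<phi> \<psi>) (simp_all add: act_add)

lemma L_scale: "L x (\<lambda>xs. sw c (\<phi> xs)) xs = sw c (L x \<phi> xs)"
  by (induction xs arbitrary: \<phi>)
    (simp_all add: act_scale vector_space_scale_zero[OF vs_w] module.scale_right_diff_distrib[OF vs_w[folded module_iff_vector_space]])

lemma D_diff: "D (\<lambda>xs. \<phi> xs - \<psi> xs) xs = D \<phi> xs - D \<psi> xs"
  by (induction xs arbitrary: \<phi> \<psi>) (simp_all add: L_diff)

lemma D_add: "D (\<lambda>xs. \<phi> xs + \<psi> xs) xs = D \<phi> xs + D \<psi> xs"
  by (induction xs arbitrary: \<phi> \<psi>) (simp_all add: L_add)

lemma D_scale: "D (\<lambda>xs. sw c (\<phi> xs)) xs = sw c (D \<phi> xs)"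
  by (induction xs arbitrary: \<phi>)
    (simp_all add: L_scale vector_space_scale_zero[OF vs_w] module.scale_right_diff_distrib[OF vs_w[folded module_iff_vector_space]])

lemma linear_L_form:
  "Form k \<phi> \<Longrightarrow> L (x + y) \<phi> xs = L x \<phi> xs + L y \<phi> xs"
  "Form k \<phi> \<Longrightarrow> L (sc c x) \<phi> xs = sw c (L x \<phi> xs)"
proof (induction xs arbitrary: k \<phi>)
  case Nil
  { case 1 show ?case by (simp add: rep_add) }
  { case 2 show ?case by (simp add: rep_scale) }
next
  case (Cons z zs)
  { case 1 show ?case
      using Cons.IH(1)[OF form_tail[OF 1]] 1 by (simp add: br_add_left form_add1) }
  { case 2 show ?case
      using Cons.IH(2)[OF form_tail[OF 2]] 2 vs_w
      by (simp add: br_scale_left form_scale1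
          module.scale_right_diff_distrib[OF vs_w[folded module_iff_vector_space]]) }
qed

lemma form_L: "Form k \<phi> \<Longrightarrow> Form k (L x \<phi>)"
proof (induction k arbitrary: \<phi>)
  case 0
  then show ?case by simp
next
  case (Suc k)
  note vs = vs_h vs_w
  have tail: "Form k (\<lambda>xs. \<phi> (y # xs))" for y using Suc.prems by simp
  have lin: "Vector_Spaces.linear sc sw (\<lambda>y. L x \<phi> (y # xs))" for xs
    using vs form_scale1[OF Suc.prems] by (simp add: Vector_Spaces.linear_iff
      form_add1[OF Suc.prems] L_add L_scale br_add_right br_scale_right
      module.scale_right_diff_distrib[OF vs_w[folded module_iff_vector_space]])
  \<comment> \<open>The two terms with \<open>br x y\<close> in the first and in the second slot
    cancel by antisymmetry.\<close>
  have alt: "L x \<phi> (y # y # xs) = 0" for y xs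
    using Suc.prems form_swap[OF Suc.prems, of "br x y" y] by simp
  have "Form k (\<lambda>xs. L x \<phi> (y # xs))" for y
    using form_diff[OF vs_w Suc.IH[OF tail] tail, of y "br x y"] by simp
  then show ?case using lin alt Suc.prems by (simp add: act_zero)
qed

lemma form_D: "Form k \<phi> \<Longrightarrow> Form (Suc k) (D \<phi>)"
proof (induction k arbitrary: \<phi>)
  case 0
  have "Form 0 (\<lambda>xs. D \<phi> (x # xs))" for x
    using form_L[OF 0, of x] 0 by simp
  moreover have "Vector_Spaces.linear sc sw (\<lambda>x. D \<phi> (x # xs))" for xs
    using vs_h vs_w 0 by (simp add: Vector_Spaces.linear_iff linear_L_form[OF 0])
  ultimately show ?case using form_L[OF 0] 0 by simp
next
  case (Suc k)
  have tail: "Form k (\<lambda>xs. \<phi> (y # xs))" for y using Suc.prems by simp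
  have lin: "Vector_Spaces.linear sc sw (\<lambda>x. D \<phi> (x # xs))" for xs
    using vs_h vs_w form_scale1[OF Suc.prems]
    by (simp add: Vector_Spaces.linear_iff linear_L_form[OF Suc.prems] D_add D_scale
      form_add1[OF Suc.prems] module.scale_right_diff_distrib[OF vs_w[folded module_iff_vector_space]])
  have alt: "D \<phi> (x # x # xs) = 0" for x xs
    using Suc.prems form_zero1[OF Suc.prems] by (simp add: br_self)
  have "Form (Suc k) (\<lambda>xs. D \<phi> (x # xs))" for x
    using form_diff[OF vs_w form_L[OF Suc.prems] Suc.IH[OF tail], of x x]
    unfolding cdiff.simps .
  then show ?case using lin alt by (simp del: form.simps add: form.simps(2)[of _ _ "Suc k"] cdiff.simps(1)) 
qed

text \<open>The Jacobi identity and the representation law enter here. The lemma implies that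
  \<open>L x\<close> commutes with \<open>D\<close>, and this in turn makes \<open>D\<close> square
  to zero by induction on the arguments, with no manipulation of double sums.\<close>

lemma L_commutator:
  "Form k \<phi> \<Longrightarrow> L x (L y \<phi>) xs - L y (L x \<phi>) xs = L (br x y) \<phi> xs"
proof (induction xs arbitrary: k \<phi>)
  case Nil
  show ?case by (simp add: rep)
next
  case (Cons z zs)
  show ?case
    using Cons.IH[OF form_tail[OF Cons.prems], of z]
    by (simp add: L_diff br_br form_diff1[OF Cons.prems] algebra_simps)
qed

lemma L_D: "Form k \<phi> \<Longrightarrow> L x (D \<phi>) xs = D (L x \<phi>) xs"
proof (induction xs arbitrary: k \<phi>)
  case Nil
  show ?case by (simp add: act_zero)
next
  case (Cons y ys)
  have "L x (D \<phi>) (y # ys) = L x (\<lambda>ys. L y \<phi> ys - D (\<lambda>zs. \<phi> (y # zs)) ys) ys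
      - L (br x y) \<phi> ys + D (\<lambda>zs. \<phi> (br x y # zs)) ys"
    by simp
  also have "\<dots> = L y (L x \<phi>) ys - D (L x (\<lambda>zs. \<phi> (y # zs))) ys + D (\<lambda>zs. \<phi> (br x y # zs)) ys"
    using L_commutator[OF Cons.prems, of x y ys] Cons.IH[OF form_tail[OF Cons.prems], of y]
    by (simp add: L_diff algebra_simps)
  also have "\<dots> = D (L x \<phi>) (y # ys)"
    by (simp add: D_diff)
  finally show ?case .
qed

lemma D_D: "Form k \<phi> \<Longrightarrow> D (D \<phi>) xs = 0"
proof (induction xs arbitrary: k \<phi>)
  case (Cons y ys)
  show ?case
    using Cons.IH[OF form_tail[OF Cons.prems], of y] L_D[OF Cons.prems, of y ys]
    by (simp add: D_diff)
qed simp

end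

section \<open>Change of coefficients and the wedge product with a 1-form\<close>

lemma lie_der_natural:
  assumes "\<And>v w. f (v - w) = f v - f w" and "\<And>v. f (\<rho> x v) = \<rho>' x (f v)"
  shows "f (lie_der br \<rho> x \<phi> xs) = lie_der br \<rho>' x (\<lambda>xs. f (\<phi> xs)) xs"
  by (induction xs arbitrary: \<phi>) (simp_all add: assms)

lemma cdiff_natural:
  assumes "\<And>v w. f (v - w) = f v - f w" and "\<And>x v. f (\<rho> x v) = \<rho>' x (f v)"
  shows "f (cdiff br \<rho> \<phi> xs) = cdiff br \<rho>' (\<lambda>xs. f (\<phi> xs)) xs"
proof -
  have "f 0 = 0" using assms(1)[of 0 0] by simp
  then show ?thesis
    by (induction xs arbitrary: \<phi>) (simp_all add: assms(1) lie_der_natural[of f \<rho> _ \<rho>', OF assms])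
qed

text \<open>The product \<eta> \<and> \<phi>, defined through the antiderivation rule for
  contraction: contracting it with x gives \<eta>(x) \<phi> minus \<eta> \<and> (the contraction of
  \<phi> with x). The shape agrees with \<open>cdiff\<close>, so the two can be compared by one
  induction.\<close>

fun wedge1 :: "(complex \<Rightarrow> 'w \<Rightarrow> 'w) \<Rightarrow> ('h \<Rightarrow> complex) \<Rightarrow> ('h list \<Rightarrow> 'w::ab_group_add) \<Rightarrow> 'h list \<Rightarrow> 'w" where
  "wedge1 sw \<eta> \<phi> [] = 0"
| "wedge1 sw \<eta> \<phi> (x # xs) = sw (\<eta> x) (\<phi> xs) - wedge1 sw \<eta> (\<lambda>zs. \<phi> (x # zs)) xs"

lemma wedge1_diff:
  "vector_space sw \<Longrightarrow> wedge1 sw \<eta> (\<lambda>xs. \<phi> xs - \<psi> xs) xs = wedge1 sw \<eta> \<phi> xs - wedge1 sw \<eta> \<psi> xs"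
  by (induction xs arbitrary: \<phi> \<psi>)
    (simp_all add: module.scale_right_diff_distrib flip: module_iff_vector_space)

lemma wedge1_scale:
  "vector_space sw \<Longrightarrow> wedge1 sw \<eta> (\<lambda>xs. sw c (\<phi> xs)) xs = sw c (wedge1 sw \<eta> \<phi> xs)"
  by (induction xs arbitrary: \<phi>)
    (simp_all add: module.scale_right_diff_distrib module.scale_scale module.scale_zero_right mult.commute
      flip: module_iff_vector_space)

lemma wedge1_wedge1: "vector_space sw \<Longrightarrow> wedge1 sw \<eta> (wedge1 sw \<eta> \<phi>) xs = 0"
  by (induction xs arbitrary: \<phi>) (simp_all add: wedge1_diff wedge1_scale)

lemma wedge1_natural:
  assumes "Vector_Spaces.linear sw sw' f"
  shows "f (wedge1 sw \<eta> \<phi> xs) = wedge1 sw' \<eta> (\<lambda>xs. f (\<phi> xs)) xs"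
proof (induction xs arbitrary: \<phi>)
  case Nil
  show ?case using linear_zero[OF assms] by simp
next
  case (Cons x xs)
  show ?case using assms Cons.IH
    by (simp add: linear_diff[OF assms]) (simp add: Vector_Spaces.linear_iff)
qed

lemma lie_der_eq_lie_der_zero:
  "lie_der br \<rho> x \<phi> xs = lie_der br (\<lambda>_ _. 0) x \<phi> xs + \<rho> x (\<phi> xs)"
  by (induction xs arbitrary: \<phi>) simp_all

lemma cdiff_eq_wedge1:
  assumes "Vector_Spaces.linear sw sw M" "\<And>x v. \<rho> x v = sw (\<eta> x) (M v)"
  shows "cdiff br \<rho> \<phi> xs = cdiff br (\<lambda>_ _. 0) \<phi> xs + M (wedge1 sw \<eta> \<phi> xs)"
proof (induction xs arbitrary: \<phi>)
  case Nil
  show ?case using linear_zero[OF assms(1)] by simp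
next
  case (Cons x xs)
  have "M (sw c v) = sw c (M v)" for c v using assms(1) by (simp add: Vector_Spaces.linear_iff)
  then show ?case
    using lie_der_eq_lie_der_zero[of br \<rho> x \<phi> xs] Cons.IH
    by (simp add: assms(2)[of x] linear_diff[OF assms(1)])
qed

section \<open>Cohomology and annihilating polynomials\<close>

text \<open>Gaussian elimination for a homogeneous system with more unknowns (indexed by
  \<open>K\<close>) than equations (indexed by \<open>S\<close>): equation \<open>s\<close> with
  pivot \<open>p\<close> eliminates the unknown \<open>c p\<close> from the others.\<close>

lemma nontrivial_relation:
  fixes a :: "'k \<Rightarrow> 's \<Rightarrow> complex"
  assumes "finite S"
  shows "finite K \<Longrightarrow> card S < card K \<Longrightarrow>
    \<exists>c. (\<exists>k\<in>K. c k \<noteq> 0) \<and> (\<forall>s\<in>S. (\<Sum>k\<in>K. c k * a k s) = 0)"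
  using assms
proof (induction S arbitrary: K a rule: finite_induct)
  case empty
  then obtain k where "k \<in> K" by fastforce
  then show ?case by (intro exI[of _ "\<lambda>_. 1"]) auto
next
  case (insert s S)
  show ?case
  proof (cases "\<forall>k\<in>K. a k s = 0")
    case True
    have "card S < card K" using insert by simp
    then obtain c where "\<exists>k\<in>K. c k \<noteq> 0" "\<forall>s\<in>S. (\<Sum>k\<in>K. c k * a k s) = 0"
      using insert.IH[of K a] insert.prems by blast
    then show ?thesis using True by (intro exI[of _ c]) auto
  next
    case False
    then obtain p where p: "p \<in> K" "a p s \<noteq> 0" by blast
    define r where "r k = a k s / a p s" for k
    have "card S < card (K - {p})" using insert p by simp
    then obtain c where c: "\<exists>k\<in>K - {p}. c k \<noteq> 0"
      "\<forall>t\<in>S. (\<Sum>k\<in>K - {p}. c k * (a k t - r k * a p t)) = 0"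
      using insert.IH[of "K - {p}" "\<lambda>k t. a k t - r k * a p t"] insert.prems by auto
    define d where "d = c(p := - (\<Sum>k\<in>K - {p}. c k * r k))"
    have eq: "(\<Sum>k\<in>K. d k * a k t) = (\<Sum>k\<in>K - {p}. c k * (a k t - r k * a p t))" for t
    proof -
      have "(\<Sum>k\<in>K. d k * a k t) = d p * a p t + (\<Sum>k\<in>K - {p}. d k * a k t)"
        using p insert.prems by (simp add: sum.remove)
      also have "\<dots> = - (\<Sum>k\<in>K - {p}. c k * r k) * a p t + (\<Sum>k\<in>K - {p}. c k * a k t)"
        by (simp add: d_def)
      finally show ?thesis
        by (simp add: sum_distrib_left sum_distrib_right algebra_simps sum_subtractf)
    qed
    have "a k s - r k * a p s = 0" for k using p by (simp add: r_def)
    then have "\<forall>t\<in>insert s S. (\<Sum>k\<in>K. d k * a k t) = 0"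
      unfolding eq using c(2) by (simp only: ball_simps mult_zero_right sum.neutral_const simp_thms)
    moreover have "\<exists>k\<in>K. d k \<noteq> 0" using c(1) by (auto simp: d_def)
    ultimately show ?thesis by blast
  qed
qed

text \<open>With \<open>a n s\<close> the entry \<open>s\<close> of the n-th power of an operator,
  this is an annihilating polynomial with its lowest power t^l split off. The cofactor then has a
  nonzero constant term and stays invertible near the zero matrix.\<close>

lemma nontrivial_relation_lowest:
  fixes a :: "nat \<Rightarrow> 's \<Rightarrow> complex"
  assumes "finite S"
  shows "\<exists>l K c. c 0 \<noteq> 0 \<and> (\<forall>s\<in>S. (\<Sum>j\<le>K. c j * a (l + j) s) = 0)"
proof -
  obtain c where c: "\<exists>k\<in>{..card S}. c k \<noteq> 0" "\<forall>s\<in>S. (\<Sum>k\<le>card S. c k * a k s) = 0"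
    using nontrivial_relation[OF assms, of "{..card S}" a] by auto
  define l where "l = (LEAST k. c k \<noteq> 0)"
  have l: "c l \<noteq> 0" "l \<le> card S"
    using c(1) LeastI[of "\<lambda>k. c k \<noteq> 0"] Least_le[of "\<lambda>k. c k \<noteq> 0"]
    by (auto simp: l_def intro: order_trans)
  have z: "c k = 0" if "k < l" for k using that not_less_Least unfolding l_def by blast
  have "(\<Sum>j\<le>card S - l. c (l + j) * a (l + j) s) = (\<Sum>k\<le>card S. c k * a k s)" for s
  proof -
    have "(\<Sum>k\<le>card S. c k * a k s) = (\<Sum>k=l..card S. c k * a k s)"
      by (rule sum.mono_neutral_right) (use z in auto)
    also have "\<dots> = (\<Sum>j\<le>card S - l. c (l + j) * a (l + j) s)"
      using l(2) by (intro sum.reindex_bij_witness[of _ "\<lambda>j. l + j" "\<lambda>k. k - l"]) auto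
    finally show ?thesis by simp
  qed
  then show ?thesis using c(2) l(1)
    by (intro exI[of _ l] exI[of _ "card S - l"] exI[of _ "\<lambda>j. c (l + j)"]) simp
qed

section \<open>Cocycles and coboundaries\<close>

definition cocycle where
  "cocycle sc sw br \<rho> k \<phi> \<longleftrightarrow> form sc sw k \<phi> \<and> cdiff br \<rho> \<phi> = (\<lambda>_. 0)"

text \<open>In degree 0 the only coboundary is 0: the predecessor \<open>A\<^bsup>-1\<^esup>\<close> is the zero space.\<close>
definition preform :: "(complex \<Rightarrow> 'h::ab_group_add \<Rightarrow> 'h) \<Rightarrow> (complex \<Rightarrow> 'w \<Rightarrow> 'w) \<Rightarrow> nat
    \<Rightarrow> ('h list \<Rightarrow> 'w::ab_group_add) \<Rightarrow> bool" where
  "preform sc sw k \<psi> \<longleftrightarrow> (case k of 0 \<Rightarrow> \<psi> = (\<lambda>_. 0) | Suc j \<Rightarrow> form sc sw j \<psi>)"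

definition coboundary where
  "coboundary sc sw br \<rho> k \<phi> \<longleftrightarrow> (\<exists>\<psi>. preform sc sw k \<psi> \<and> (\<forall>xs. cdiff br \<rho> \<psi> xs = \<phi> xs))"

lemma preform_lin_comp:
  assumes "Vector_Spaces.linear sw sw' f"
  shows "preform sc sw k \<psi> \<Longrightarrow> preform sc sw' k (\<lambda>xs. f (\<psi> xs))"
  using form_lin_comp[OF assms] linear_zero[OF assms] by (auto simp: preform_def split: nat.splits)

lemma cocycle_lin_comp:
  assumes "Vector_Spaces.linear sw sw' f" "\<And>x v. f (\<rho> x v) = \<rho>' x (f v)"
    and "cocycle sc sw br \<rho> k \<phi>"
  shows "cocycle sc sw' br \<rho>' k (\<lambda>xs. f (\<phi> xs))"
proof -
  have "cdiff br \<rho>' (\<lambda>xs. f (\<phi> xs)) xs = f (cdiff br \<rho> \<phi> xs)" for xs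
    by (rule cdiff_natural[symmetric]) (simp_all add: linear_diff[OF assms(1)] assms(2))
  then show ?thesis using assms(3) form_lin_comp[OF assms(1)] linear_zero[OF assms(1)]
    by (auto simp: cocycle_def)
qed

lemma coboundary_lin_comp:
  assumes "Vector_Spaces.linear sw sw' f" "\<And>x v. f (\<rho> x v) = \<rho>' x (f v)"
    and "coboundary sc sw br \<rho> k \<phi>"
  shows "coboundary sc sw' br \<rho>' k (\<lambda>xs. f (\<phi> xs))"
proof -
  obtain \<psi> where \<psi>: "preform sc sw k \<psi>" "\<And>xs. cdiff br \<rho> \<psi> xs = \<phi> xs"
    using assms(3) by (auto simp: coboundary_def)
  have "cdiff br \<rho>' (\<lambda>xs. f (\<psi> xs)) xs = f (\<phi> xs)" for xs
    unfolding \<psi>(2)[symmetric]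
    by (rule cdiff_natural[symmetric]) (simp_all add: linear_diff[OF assms(1)] assms(2))
  then show ?thesis using preform_lin_comp[OF assms(1) \<psi>(1)] by (auto simp: coboundary_def)
qed

context lie_module
begin

abbreviation "Preform \<equiv> preform sc sw"
abbreviation "Cocycle \<equiv> cocycle sc sw br \<rho>"
abbreviation "Coboundary \<equiv> coboundary sc sw br \<rho>"

lemma preform_zero: "Preform k (\<lambda>_. 0)"
  using form_zero[OF vs_h vs_w] by (auto simp: preform_def split: nat.splits)

lemma preform_add: "Preform k \<phi> \<Longrightarrow> Preform k \<psi> \<Longrightarrow> Preform k (\<lambda>xs. \<phi> xs + \<psi> xs)"
  using form_add by (auto simp: preform_def split: nat.splits)

lemma preform_tail: "Form k \<phi> \<Longrightarrow> Preform k (\<lambda>xs. \<phi> (x # xs))"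
  by (cases k) (auto simp: preform_def)

lemma form_D_preform: "Preform k \<psi> \<Longrightarrow> Form k (D \<psi>)"
  using form_D form_zero[OF vs_h vs_w] by (cases k) (auto simp: preform_def simp del: form.simps)

lemma D_D_preform: "Preform k \<psi> \<Longrightarrow> D (D \<psi>) xs = 0"
  using D_D by (cases k) (auto simp: preform_def)

lemma cocycle_D: "Preform k \<psi> \<Longrightarrow> Cocycle k (D \<psi>)"
  using form_D_preform D_D_preform by (auto simp: cocycle_def)

lemma cocycle_form: "Cocycle k \<phi> \<Longrightarrow> Form k \<phi>"
  by (simp add: cocycle_def)

lemma cocycle_add: "Cocycle k \<phi> \<Longrightarrow> Cocycle k \<psi> \<Longrightarrow> Cocycle k (\<lambda>xs. \<phi> xs + \<psi> xs)"
  using form_add by (auto simp: cocycle_def D_add)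

lemma cocycle_diff: "Cocycle k \<phi> \<Longrightarrow> Cocycle k \<psi> \<Longrightarrow> Cocycle k (\<lambda>xs. \<phi> xs - \<psi> xs)"
  using form_diff[OF vs_w] by (auto simp: cocycle_def D_diff)

lemma coboundary_D: "Preform k \<psi> \<Longrightarrow> Coboundary k (D \<psi>)"
  by (auto simp: coboundary_def)

lemma coboundary_zero: "Coboundary k (\<lambda>_. 0)"
  using coboundary_D[OF preform_zero] by simp

lemma coboundary_add:
  assumes "Coboundary k \<phi>" "Coboundary k \<psi>"
  shows "Coboundary k (\<lambda>xs. \<phi> xs + \<psi> xs)"
proof -
  obtain \<alpha> \<beta> where "Preform k \<alpha>" "\<And>xs. D \<alpha> xs = \<phi> xs" "Preform k \<beta>" "\<And>xs. D \<beta> xs = \<psi> xs"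
    using assms by (auto simp: coboundary_def)
  then show ?thesis using preform_add[of k \<alpha> \<beta>]
    unfolding coboundary_def by (intro exI[of _ "\<lambda>xs. \<alpha> xs + \<beta> xs"]) (simp add: D_add)
qed

lemma coboundary_scale: "Coboundary k \<phi> \<Longrightarrow> Coboundary k (\<lambda>xs. sw c (\<phi> xs))"
  by (rule coboundary_lin_comp[OF linear_scaleI[OF vs_w]]) (simp_all add: act_scale)

lemma coboundary_sum:
  "finite I \<Longrightarrow> (\<And>i. i \<in> I \<Longrightarrow> Coboundary k (\<phi> i)) \<Longrightarrow> Coboundary k (\<lambda>xs. \<Sum>i\<in>I. \<phi> i xs)"
  by (induction I rule: finite_induct) (auto intro: coboundary_zero coboundary_add)

lemma form_sum:
  "finite I \<Longrightarrow> (\<And>i. i \<in> I \<Longrightarrow> Form k (\<phi> i)) \<Longrightarrow> Form k (\<lambda>xs. \<Sum>i\<in>I. \<phi> i xs)"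
  by (induction I rule: finite_induct) (auto intro: form_zero[OF vs_h vs_w] form_add)

text \<open>Degree 0 is settled by the conjunct \<open>\<phi> \<noteq> (\<lambda>_. 0)\<close>, as
  zero is the only coboundary there. In positive degree zero is a coboundary too, so both
  descriptions of non-exactness agree.\<close>

lemma ce_H_nonzero_iff:
  "ce_H_nonzero sc sw br \<rho> k \<longleftrightarrow> (\<exists>\<phi>. Cocycle k \<phi> \<and> \<not> Coboundary k \<phi>)"
proof -
  have eq: "ce_d sw br \<rho> \<phi> = D \<phi>" if "Form j \<phi>" for j \<phi>
    using ce_d_eq_cdiff[OF vs_w that] by auto
  have "(\<phi> \<noteq> (\<lambda>_. 0) \<and> \<not> (\<exists>\<psi>. 0 < k \<and> Form (k - 1) \<psi> \<and> ce_d sw br \<rho> \<psi> = \<phi>)) \<longleftrightarrow> \<not> Coboundary k \<phi>"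
    for \<phi>
  proof (cases k)
    case 0
    have "Coboundary 0 \<phi> \<longleftrightarrow> \<phi> = (\<lambda>_. 0)"
      by (auto simp: coboundary_def preform_def)
    then show ?thesis using 0 by simp
  next
    case (Suc j)
    have "(\<exists>\<psi>. Form j \<psi> \<and> ce_d sw br \<rho> \<psi> = \<phi>) \<longleftrightarrow> Coboundary k \<phi>"
      using eq Suc by (auto simp: coboundary_def preform_def fun_eq_iff)
    moreover have "\<phi> = (\<lambda>_. 0) \<Longrightarrow> Coboundary k \<phi>" using coboundary_zero by simp
    ultimately show ?thesis using Suc by auto
  qed
  then have "(Form k \<phi> \<and> ce_d sw br \<rho> \<phi> = (\<lambda>_. 0) \<and> \<phi> \<noteq> (\<lambda>_. 0)
      \<and> \<not> (\<exists>\<psi>. 0 < k \<and> Form (k - 1) \<psi> \<and> ce_d sw br \<rho> \<psi> = \<phi>)) \<longleftrightarrow> Cocycle k \<phi> \<and> \<not> Coboundary k \<phi>" for \<phi>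
    unfolding cocycle_def using eq[of k \<phi>] by (cases "Form k \<phi>") simp_all
  then show ?thesis
    unfolding ce_H_nonzero_def cochain_iff_form[OF vs_h vs_w] by simp
qed

text \<open>Homotopy: since \<open>L\<^sub>b\<close> is null-homotopic, the trivial-coefficient part of \<open>L\<^sub>b\<close> acts on
cohomology as \<open>- \<rho>(b)\<close>.\<close>
lemma lie_der_power_cohomologous:
  assumes comm: "\<And>x v. \<rho> x (\<rho> b v) = \<rho> b (\<rho> x v)" and "Cocycle k \<phi>"
  defines "T \<equiv> lie_der br (\<lambda>_ _. 0) b"
  shows "Cocycle k ((T ^^ n) \<phi>) \<and> Coboundary k (\<lambda>xs. (T ^^ n) \<phi> xs - ((\<lambda>v. - \<rho> b v) ^^ n) (\<phi> xs))"
proof (induction n)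
  case 0
  then show ?case using assms(2) coboundary_zero by simp
next
  case (Suc n)
  define \<tau> where "\<tau> = (T ^^ n) \<phi>"
  define P where "P v = - \<rho> b v" for v
  have linP: "Vector_Spaces.linear sw sw P"
    using vs_w unfolding P_def Vector_Spaces.linear_iff
    by (simp add: act_add act_scale vector_space_scale_minus_one[OF vs_w] module.scale_minus_right flip: module_iff_vector_space)
  have Pcomm: "P (\<rho> x v) = \<rho> x (P v)" for x v
    using linear_minus[OF linear_act] comm by (simp add: P_def)
  have \<tau>: "Cocycle k \<tau>" "Coboundary k (\<lambda>xs. \<tau> xs - (P ^^ n) (\<phi> xs))"
    using Suc.IH by (simp_all add: \<tau>_def P_def[abs_def])
  have pre: "Preform k (\<lambda>xs. \<tau> (b # xs))" using preform_tail[OF cocycle_form[OF \<tau>(1)]] .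
  \<comment> \<open>For a cocycle, \<open>D \<tau> (b # xs) = 0\<close> is Cartan's formula: the
    full Lie derivative of \<open>\<tau>\<close> is \<open>D\<close> of its contraction with
    \<open>b\<close>.\<close>
  have T: "T \<tau> xs = D (\<lambda>xs. \<tau> (b # xs)) xs + P (\<tau> xs)" for xs
  proof -
    have "D \<tau> (b # xs) = 0" using \<tau>(1) by (simp add: cocycle_def)
    then show ?thesis using lie_der_eq_lie_der_zero[of br \<rho> b \<tau> xs]
      by (simp add: P_def T_def algebra_simps)
  qed
  have "Cocycle k (\<lambda>xs. D (\<lambda>xs. \<tau> (b # xs)) xs + P (\<tau> xs))"
    by (intro cocycle_add cocycle_D pre cocycle_lin_comp[OF linP Pcomm \<tau>(1)])
  moreover have "Coboundary k (\<lambda>xs. D (\<lambda>xs. \<tau> (b # xs)) xs + P (\<tau> xs - (P ^^ n) (\<phi> xs)))"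
    by (intro coboundary_add coboundary_D pre coboundary_lin_comp[OF linP Pcomm \<tau>(2)])
  ultimately show ?case
    by (simp add: T[abs_def] linear_diff[OF linP] algebra_simps flip: \<tau>_def P_def)
qed

end

section \<open>Annihilating polynomials of Lie derivatives with trivial coefficients\<close>

locale fd_trivial_module = lie_module sc br sw "\<lambda>_ _. 0"
  for sc :: "complex \<Rightarrow> 'h::ab_group_add \<Rightarrow> 'h" and br and sw :: "complex \<Rightarrow> 'w::ab_group_add \<Rightarrow> 'w" +
  fixes B :: "'h set"
  assumes finB: "finite_dimensional_vector_space sc B"
begin

definition grid :: "nat \<Rightarrow> 'h list set" where
  "grid k = {xs. set xs \<subseteq> B \<and> length xs = k}"

lemma finite_grid: "finite (grid k)"
  using finite_dimensional_vector_space.finite_Basis[OF finB] finite_lists_length_eq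
  unfolding grid_def by blast

text \<open>The weights are complex numbers, fixed for all \<open>\<phi>\<close>, although the
  cochains take values in \<open>'w\<close>. An operator on cochains thus becomes a finite complex
  matrix indexed by \<open>grid k\<close>, whatever the coefficient space is.\<close>

definition evaluable :: "nat \<Rightarrow> (('h list \<Rightarrow> 'w) \<Rightarrow> 'w) \<Rightarrow> bool" where
  "evaluable k F \<longleftrightarrow> (\<exists>m. \<forall>\<phi>. Form k \<phi> \<longrightarrow> F \<phi> = (\<Sum>ys\<in>grid k. sw (m ys) (\<phi> ys)))"

lemma mod_w: "module sw"
  using vs_w by (simp add: module_iff_vector_space)

lemma evaluable_cong: "evaluable k F \<Longrightarrow> (\<And>\<phi>. Form k \<phi> \<Longrightarrow> F \<phi> = G \<phi>) \<Longrightarrow> evaluable k G"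
  by (auto simp: evaluable_def)

lemma evaluable_zero: "evaluable k (\<lambda>_. 0)"
  unfolding evaluable_def by (rule exI[of _ "\<lambda>_. 0"]) (simp add: module.scale_zero_left[OF mod_w])

lemma evaluable_add: "evaluable k F \<Longrightarrow> evaluable k G \<Longrightarrow> evaluable k (\<lambda>\<phi>. F \<phi> + G \<phi>)"
proof -
  assume "evaluable k F" "evaluable k G"
  then obtain m n where "\<forall>\<phi>. Form k \<phi> \<longrightarrow> F \<phi> = (\<Sum>ys\<in>grid k. sw (m ys) (\<phi> ys))"
     "\<forall>\<phi>. Form k \<phi> \<longrightarrow> G \<phi> = (\<Sum>ys\<in>grid k. sw (n ys) (\<phi> ys))" unfolding evaluable_def by blast
  then show ?thesis unfolding evaluable_def
    by (intro exI[of _ "\<lambda>ys. m ys + n ys"]) (simp add: sum.distrib module.scale_left_distrib[OF mod_w])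
qed

lemma evaluable_scale: "evaluable k F \<Longrightarrow> evaluable k (\<lambda>\<phi>. sw c (F \<phi>))"
proof -
  assume "evaluable k F"
  then obtain m where "\<forall>\<phi>. Form k \<phi> \<longrightarrow> F \<phi> = (\<Sum>ys\<in>grid k. sw (m ys) (\<phi> ys))"
    unfolding evaluable_def by blast
  then show ?thesis unfolding evaluable_def
    by (intro exI[of _ "\<lambda>ys. c * m ys"])
      (simp add: module.scale_sum_right[OF mod_w] module.scale_scale[OF mod_w])
qed

lemma evaluable_minus: "evaluable k F \<Longrightarrow> evaluable k (\<lambda>\<phi>. - F \<phi>)"
  using evaluable_scale[of k F "-1"] by (simp add: vector_space_scale_minus_one[OF vs_w])

lemma evaluable_sum:
  "finite I \<Longrightarrow> (\<And>i. i \<in> I \<Longrightarrow> evaluable k (F i)) \<Longrightarrow> evaluable k (\<lambda>\<phi>. \<Sum>i\<in>I. F i \<phi>)"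
  by (induction I rule: finite_induct) (auto intro: evaluable_zero evaluable_add)

lemma evaluable_grid: "ys \<in> grid k \<Longrightarrow> evaluable k (\<lambda>\<phi>. \<phi> ys)"
  unfolding evaluable_def
proof (intro exI[of _ "\<lambda>zs. if zs = ys then 1 else 0"] allI impI)
  fix \<phi> :: "'h list \<Rightarrow> 'w"
  assume ys: "ys \<in> grid k"
  have "(\<Sum>zs\<in>grid k. sw (if zs = ys then 1 else 0) (\<phi> zs)) = (\<Sum>zs\<in>grid k. if zs = ys then \<phi> zs else 0)"
    by (rule sum.cong) (auto simp: module.scale_one[OF mod_w] module.scale_zero_left[OF mod_w])
  then show "\<phi> ys = (\<Sum>zs\<in>grid k. sw (if zs = ys then 1 else 0) (\<phi> zs))"
    using ys finite_grid by simp
qed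

lemma basis_expansion: "\<exists>r. x = (\<Sum>b\<in>B. sc (r b) b)"
proof -
  interpret finite_dimensional_vector_space sc B by (rule finB)
  have "x \<in> range (\<lambda>r. \<Sum>b\<in>B. sc (r b) b)"
    unfolding span_finite[OF finite_Basis, symmetric] span_Basis by (rule UNIV_I)
  then show ?thesis by (rule imageE) blast
qed

lemma form_sum1:
  "finite I \<Longrightarrow> Form k \<phi> \<Longrightarrow> \<phi> ((\<Sum>i\<in>I. sc (r i) (f i)) # xs) = (\<Sum>i\<in>I. sw (r i) (\<phi> (f i # xs)))"
  by (induction I rule: finite_induct) (simp_all add: form_zero1 form_add1 form_scale1[OF _ vs_w])

lemma evaluable_eval: "length xs = k \<Longrightarrow> evaluable k (\<lambda>\<phi>. \<phi> xs)"
proof (induction k arbitrary: xs)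
  case 0
  then show ?case by (intro evaluable_grid) (simp add: grid_def)
next
  case (Suc k)
  then obtain x ys where xs: "xs = x # ys" "length ys = k" by (cases xs) auto
  obtain r where r: "x = (\<Sum>b\<in>B. sc (r b) b)" using basis_expansion by blast
  have finite: "finite B" by (rule finite_dimensional_vector_space.finite_Basis[OF finB])
  have "evaluable (Suc k) (\<lambda>\<phi>. \<phi> (b # ys))" if b: "b \<in> B" for b
  proof -
    obtain m where m: "\<And>\<phi>. Form k \<phi> \<Longrightarrow> \<phi> ys = (\<Sum>zs\<in>grid k. sw (m zs) (\<phi> zs))"
      using Suc.IH[OF xs(2)] unfolding evaluable_def by blast
    have "evaluable (Suc k) (\<lambda>\<phi>. \<Sum>zs\<in>grid k. sw (m zs) (\<phi> (b # zs)))"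
      by (intro evaluable_sum finite_grid evaluable_scale evaluable_grid) (use b in \<open>auto simp: grid_def\<close>)
    then show ?thesis
      by (rule evaluable_cong) (use m[of "\<lambda>zs. _ (b # zs)"] form_tail in force)
  qed
  then have "evaluable (Suc k) (\<lambda>\<phi>. \<Sum>b\<in>B. sw (r b) (\<phi> (b # ys)))"
    by (intro evaluable_sum finite evaluable_scale)
  then show ?case
  proof (rule evaluable_cong)
    fix \<phi> assume "Form (Suc k) \<phi>"
    from form_sum1[OF finite this, of r "\<lambda>b. b" ys]
    show "(\<Sum>b\<in>B. sw (r b) (\<phi> (b # ys))) = \<phi> xs" unfolding xs(1) r[symmetric] by (rule sym)
  qed
qed

lemma form_L_power: "Form k \<phi> \<Longrightarrow> Form k ((L x ^^ n) \<phi>)"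
  by (induction n) (auto intro: form_L simp del: form.simps)

lemma evaluable_L_power: "length xs = k \<Longrightarrow> evaluable k (\<lambda>\<phi>. (L x ^^ n) \<phi> xs)"
proof (induction n)
  case 0
  then show ?case by (simp add: evaluable_eval)
next
  case (Suc n)
  obtain m where m: "\<And>\<phi>. Form k \<phi> \<Longrightarrow> (L x ^^ n) \<phi> xs = (\<Sum>ys\<in>grid k. sw (m ys) (\<phi> ys))"
    using Suc.IH[OF Suc.prems] unfolding evaluable_def by blast
  have "evaluable k (\<lambda>\<phi>. \<Sum>ys\<in>grid k. sw (m ys) (- (\<Sum>j<length ys. \<phi> (ys[j := br x (ys ! j)]))))"
    by (intro evaluable_sum finite_grid evaluable_scale evaluable_minus evaluable_eval)
      (auto simp: grid_def)
  then show ?case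
  proof (rule evaluable_cong)
    fix \<phi> assume "Form k \<phi>"
    then have "(L x ^^ Suc n) \<phi> xs = (\<Sum>ys\<in>grid k. sw (m ys) (L x \<phi> ys))"
      using m[OF form_L] by (simp add: funpow_swap1)
    then show "(\<Sum>ys\<in>grid k. sw (m ys) (- (\<Sum>j<length ys. \<phi> (ys[j := br x (ys ! j)])))) = (L x ^^ Suc n) \<phi> xs"
      by (simp only: lie_der_eq_sum diff_0)
  qed
qed

text \<open>The matrices of the powers of \<open>L x\<close> on basis values have finitely many
  entries, hence satisfy a linear relation; a form that vanishes on \<open>grid k\<close> vanishes.
  The numbers \<open>l\<close>, \<open>K\<close> and \<open>c\<close> are chosen before
  \<open>\<phi>\<close>, which is what later makes the neighbourhood of 0 uniform.\<close>

lemma L_annihilator: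
  "\<exists>l K c. c 0 \<noteq> 0 \<and> (\<forall>\<phi> xs. Form k \<phi> \<longrightarrow> (\<Sum>j\<le>K. sw (c j) ((L x ^^ (l + j)) \<phi> xs)) = 0)"
proof -
  have "\<forall>n. \<forall>xs\<in>grid k. \<exists>m. \<forall>\<phi>. Form k \<phi> \<longrightarrow> (L x ^^ n) \<phi> xs = (\<Sum>ys\<in>grid k. sw (m ys) (\<phi> ys))"
    using evaluable_L_power[where k = k and x = x] by (auto simp: grid_def evaluable_def)
  then obtain m where m: "\<And>n xs \<phi>. xs \<in> grid k \<Longrightarrow> Form k \<phi> \<Longrightarrow>
      (L x ^^ n) \<phi> xs = (\<Sum>ys\<in>grid k. sw (m n xs ys) (\<phi> ys))" by metis
  obtain l K c where "c 0 \<noteq> 0"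
    "\<forall>s\<in>grid k \<times> grid k. (\<Sum>j\<le>K. c j * m (l + j) (fst s) (snd s)) = 0"
    using nontrivial_relation_lowest[of "grid k \<times> grid k" "\<lambda>n s. m n (fst s) (snd s)"] finite_grid
    by blast
  then have c: "c 0 \<noteq> 0"
    "\<And>xs ys. xs \<in> grid k \<Longrightarrow> ys \<in> grid k \<Longrightarrow> (\<Sum>j\<le>K. c j * m (l + j) xs ys) = 0"
    by auto
  have "(\<Sum>j\<le>K. sw (c j) ((L x ^^ (l + j)) \<phi> xs)) = 0" if \<phi>: "Form k \<phi>" for \<phi> xs
  proof -
    define \<psi> where "\<psi> xs = (\<Sum>j\<le>K. sw (c j) ((L x ^^ (l + j)) \<phi> xs))" for xs
    have form: "Form k \<psi>" unfolding \<psi>_def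
      by (intro form_sum form_scale[OF vs_w] form_L_power \<phi>) simp
    have grid: "\<psi> xs = 0" if xs: "xs \<in> grid k" for xs
    proof -
      have "\<psi> xs = (\<Sum>j\<le>K. \<Sum>ys\<in>grid k. sw (c j * m (l + j) xs ys) (\<phi> ys))"
        unfolding \<psi>_def m[OF xs \<phi>] by (simp add: module.scale_sum_right[OF mod_w] module.scale_scale[OF mod_w])
      also have "\<dots> = (\<Sum>ys\<in>grid k. sw (\<Sum>j\<le>K. c j * m (l + j) xs ys) (\<phi> ys))"
        by (subst sum.swap) (simp add: module.scale_sum_left[OF mod_w])
      also have "\<dots> = 0" using c(2)[OF xs] by (simp add: module.scale_zero_left[OF mod_w])
      finally show ?thesis .
    qed
    have "\<psi> xs = 0"
    proof (cases "length xs = k")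
      case True
      then obtain n where "\<psi> xs = (\<Sum>ys\<in>grid k. sw (n ys) (\<psi> ys))"
        using evaluable_eval form unfolding evaluable_def by blast
      then show ?thesis using grid by (simp add: module.scale_zero_right[OF mod_w])
    qed (use form form_length in blast)
    then show ?thesis by (simp add: \<psi>_def)
  qed
  then show ?thesis using c(1) by blast
qed

end

section \<open>Twists by a rank one connection\<close>

lemma vector_space_mscale: "vector_space (mscale :: complex \<Rightarrow> complex^'n^'m \<Rightarrow> complex^'n^'m)"
  by unfold_locales (simp_all add: mscale_def vec_eq_iff algebra_simps)

lemma mscale_mult_vec: "mscale c A *v v = c *s (A *v v)" for c :: complex
  by (simp add: mscale_def matrix_vector_mult_def vec_eq_iff sum_distrib_left mult.assoc)

lemma mscale_mult_left: "mscale c A ** B = mscale c (A ** B)" for c :: complex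
  by (simp add: mscale_def matrix_matrix_mult_def vec_eq_iff sum_distrib_left mult.assoc)

lemma mscale_mult_right: "A ** mscale c B = mscale c (A ** B)" for c :: complex
  by (simp add: mscale_def matrix_matrix_mult_def vec_eq_iff sum_distrib_left mult_ac)

lemma mscale_mscale: "mscale c (mscale d X) = mscale (c * d) X" for c :: complex
  by (simp add: mscale_def vec_eq_iff)

primrec mpow :: "'a::semiring_1^'n^'n \<Rightarrow> nat \<Rightarrow> 'a^'n^'n" where
  "mpow A 0 = mat 1"
| "mpow A (Suc n) = A ** mpow A n"

definition mpoly :: "(nat \<Rightarrow> complex) \<Rightarrow> nat \<Rightarrow> complex^'n^'n \<Rightarrow> complex^'n^'n" where
  "mpoly c K A = (\<Sum>j\<le>K. mscale (c j) (mpow A j))"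

lemma mpow_add: "mpow A (m + n) = mpow A m ** mpow A n"
  by (induction m) (simp_all add: matrix_mul_assoc)

lemma mpow_commute: "X ** A = A ** X \<Longrightarrow> X ** mpow A n = mpow A n ** X"
  by (induction n) (simp_all, metis matrix_mul_assoc)

lemma mpow_mult_vec: "mpow A n *v v = (((*v) A) ^^ n) v"
  by (induction n) (simp_all flip: matrix_vector_mul_assoc)

lemma mpow_mscale: "mpow (mscale c A) n = mscale (c ^ n) (mpow A n)" for c :: complex
proof (induction n)
  case 0
  show ?case by (simp add: mscale_def vec_eq_iff)
qed (simp add: mscale_mult_left mscale_mult_right mscale_mscale mult.commute)

lemma mpow_inverse:
  assumes "A ** B = mat 1" "B ** A = mat 1" shows "mpow A n ** mpow B n = mat 1"
proof (induction n)
  case (Suc n)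
  have "A ** B = B ** A" using assms by simp
  then have "A ** mpow B n = mpow B n ** A" by (rule mpow_commute)
  then have "mpow A (Suc n) ** mpow B (Suc n) = mpow A n ** (A ** B) ** mpow B n"
    by (metis mpow.simps(2) mpow_commute matrix_mul_assoc)
  then show ?case using Suc assms by simp
qed simp

lemma matrix_mult_add_left: "(A + B) ** C = A ** C + B ** C" for C :: "complex^'n^'n"
  by (simp add: matrix_matrix_mult_def vec_eq_iff sum.distrib distrib_right)

lemma matrix_vector_mult_sum_left: "(\<Sum>i\<in>I. f i) *v v = (\<Sum>i\<in>I. f i *v v)" for v :: "complex^'n"
  by (induction I rule: infinite_finite_induct) (simp_all add: matrix_vector_mult_add_rdistrib)

lemma matrix_mult_sum_left: "(\<Sum>i\<in>I. f i) ** B = (\<Sum>i\<in>I. f i ** B)" for B :: "complex^'n^'n"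
  by (induction I rule: infinite_finite_induct) (simp_all add: matrix_mult_add_left)

lemma matrix_mult_sum_right: "B ** (\<Sum>i\<in>I. f i) = (\<Sum>i\<in>I. B ** f i)" for B :: "complex^'n^'n"
  by (induction I rule: infinite_finite_induct) (simp_all add: matrix_add_ldistrib)

lemma mpoly_commute: "X ** A = A ** X \<Longrightarrow> X ** mpoly c K A = mpoly c K A ** X"
  unfolding mpoly_def matrix_mult_sum_left matrix_mult_sum_right
  by (simp add: mscale_mult_left mscale_mult_right mpow_commute)

lemma mpoly_mult_mpow: "mpoly c K A ** mpow A l = (\<Sum>j\<le>K. mscale (c j) (mpow A (l + j)))"
  unfolding mpoly_def matrix_mult_sum_left
  by (simp add: mscale_mult_left add.commute flip: mpow_add)

lemma tendsto_matrix_mult: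
  fixes f :: "'a \<Rightarrow> complex^'n^'n"
  assumes "(f \<longlongrightarrow> A) F" "(g \<longlongrightarrow> B) F"
  shows "((\<lambda>x. f x ** g x) \<longlongrightarrow> A ** B) F"
  unfolding matrix_matrix_mult_def
  by (intro tendsto_vec_lambda tendsto_sum tendsto_mult tendsto_vec_nth assms)

lemma tendsto_mscale:
  fixes g :: "'a \<Rightarrow> complex^'n^'n"
  assumes "(f \<longlongrightarrow> c) F" "(g \<longlongrightarrow> B) F"
  shows "((\<lambda>x. mscale (f x) (g x)) \<longlongrightarrow> mscale c B) F"
  unfolding mscale_def by (intro tendsto_vec_lambda tendsto_mult tendsto_vec_nth assms)

lemma tendsto_mpow:
  fixes f :: "'a \<Rightarrow> complex^'n^'n"
  shows "(f \<longlongrightarrow> A) F \<Longrightarrow> ((\<lambda>x. mpow (f x) n) \<longlongrightarrow> mpow A n) F"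
  by (induction n) (auto intro: tendsto_matrix_mult)

lemma tendsto_det:
  fixes f :: "'a \<Rightarrow> complex^'n^'n"
  shows "(f \<longlongrightarrow> A) F \<Longrightarrow> ((\<lambda>x. det (f x)) \<longlongrightarrow> det A) F"
  unfolding det_def by (intro tendsto_sum tendsto_mult tendsto_const tendsto_prod tendsto_vec_nth)

text \<open>At the zero matrix the polynomial equals \<open>c 0\<close> times the identity, which is
  invertible, and the determinant is continuous. This is the source of every smallness condition on
  \<omega>.\<close>

lemma det_mpoly_nonzero:
  fixes f :: "'a \<Rightarrow> complex^'n^'n"
  assumes "(f \<longlongrightarrow> 0) F" "c 0 \<noteq> 0"
  shows "\<forall>\<^sub>F x in F. det (mpoly c K (f x)) \<noteq> 0"
proof (rule tendsto_imp_eventually_ne)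
  show "((\<lambda>x. det (mpoly c K (f x))) \<longlongrightarrow> det (mpoly c K (0 :: complex^'n^'n))) F"
    unfolding mpoly_def
    by (intro tendsto_det tendsto_sum tendsto_mscale tendsto_const tendsto_mpow assms)
  have "mscale (c j) (mpow (0 :: complex^'n^'n) j) = (if j = 0 then mat (c 0) else 0)" for j
    by (cases j) (auto simp: mscale_def mat_def vec_eq_iff)
  then have "mpoly c K (0 :: complex^'n^'n) = mat (c 0)"
    by (simp add: mpoly_def)
  moreover have "det (mat (c 0) :: complex^'n^'n) = (\<Prod>i\<in>(UNIV :: 'n set). c 0)"
    by (subst det_diagonal) (simp_all add: mat_def)
  ultimately show "det (mpoly c K (0 :: complex^'n^'n)) \<noteq> 0" using assms(2) by simp
qed

lemma matrix_inverse_commuting: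
  fixes Q :: "complex^'n^'n"
  assumes "det Q \<noteq> 0"
  obtains R where "R ** Q = mat 1" "Q ** R = mat 1"
    "\<And>A. A ** Q = Q ** A \<Longrightarrow> R ** A = A ** R"
proof -
  obtain R where R: "R ** Q = mat 1" "Q ** R = mat 1"
    using assms invertible_det_nz[of Q] unfolding invertible_def by blast
  have "R ** A = A ** R" if "A ** Q = Q ** A" for A
  proof -
    have "R ** A = R ** (A ** Q) ** R" using R by (simp flip: matrix_mul_assoc)
    also have "\<dots> = A ** R" using R by (simp add: that matrix_mul_assoc)
    finally show ?thesis .
  qed
  with R show thesis using that by blast
qed

text \<open>A weak Fitting decomposition: \<open>1 - R\<^sup>l M\<^sup>l\<close> maps into the generalised kernel of \<open>M\<close>.\<close>
lemma mpow_stable: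
  fixes M :: "complex^'n^'n"
  obtains n R where "R ** M = M ** R" "\<And>l. mpow M n = mpow R l ** mpow M l ** mpow M n"
proof -
  obtain n K c where c: "c 0 \<noteq> 0"
    "\<forall>s\<in>UNIV. (\<Sum>j\<le>K. c j * mpow M (n + j) $ fst s $ snd s) = 0"
    using nontrivial_relation_lowest[of UNIV "\<lambda>n (s :: 'n \<times> 'n). mpow M n $ fst s $ snd s"] by auto
  define S where "S = (\<Sum>j<K. mscale (c (Suc j)) (mpow M j))"
  \<comment> \<open>The relation found above says that \<open>c 0\<close> times the identity plus
    \<open>M ** S\<close> annihilates \<open>mpow M n\<close>. Solving for \<open>mpow M n\<close>
    gives \<open>R ** M ** mpow M n\<close>, and iteration gives the power \<open>l\<close>.\<close>
  define R where "R = mscale (- 1 / c 0) S"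
  have SM: "M ** S = S ** M"
    unfolding S_def matrix_mult_sum_left matrix_mult_sum_right
    by (simp add: mscale_mult_left mscale_mult_right mpow_commute)
  then have RM: "R ** M = M ** R" by (simp add: R_def mscale_mult_left mscale_mult_right)
  have "mpoly c K M ** mpow M n = 0"
    using c(2) by (simp add: mpoly_mult_mpow vec_eq_iff mscale_def)
  moreover have "mpoly c K M = mscale (c 0) (mat 1) + M ** S"
    by (simp add: mpoly_def S_def sum.atMost_shift matrix_mult_sum_right mscale_mult_right)
  ultimately have "mscale (c 0) (mpow M n) + M ** S ** mpow M n = 0"
    by (simp add: matrix_mult_add_left mscale_mult_left)
  then have "mscale (- 1 / c 0) (mscale (c 0) (mpow M n) + M ** S ** mpow M n) = 0"
    by (simp only: vector_space_scale_zero[OF vector_space_mscale])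
  then have "mscale (- 1) (mpow M n) + R ** M ** mpow M n = 0"
    using c(1) by (simp add: module.scale_right_distrib[OF vector_space_mscale[folded module_iff_vector_space]]
        mscale_mscale R_def mscale_mult_left SM)
  then have 1: "mpow M n = R ** M ** mpow M n" by (simp add: vector_space_scale_minus_one[OF vector_space_mscale])
  have "mpow M n = mpow R l ** mpow M l ** mpow M n" for l
  proof (induction l)
    case (Suc l)
    have "mpow R (Suc l) ** mpow M (Suc l) = (R ** M) ** (mpow R l ** mpow M l)"
      using mpow_commute[of M R l, OF RM[symmetric]] by (metis mpow.simps(2) matrix_mul_assoc)
    then show ?case using 1 Suc by (metis matrix_mul_assoc)
  qed simp
  with RM show thesis using that by blast
qed

lemma linear_vec_nth: "Vector_Spaces.linear ((*s) :: complex \<Rightarrow> complex^'m \<Rightarrow> complex^'m) (*) (\<lambda>v. v $ i)"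
  by (simp add: Vector_Spaces.linear_iff vec.vector_space_axioms vector_space_over_itself.vector_space_axioms)

lemma linear_scale_vec: "Vector_Spaces.linear (*) ((*s) :: complex \<Rightarrow> complex^'m \<Rightarrow> complex^'m) (\<lambda>c. c *s v)"
  by (simp add: Vector_Spaces.linear_iff vec.vector_space_axioms vector_space_over_itself.vector_space_axioms
      vec.scale_left_distrib)

lemma form_vec:
  assumes "vector_space sc"
  shows "(\<And>i. form sc (*) k (\<lambda>xs. \<phi> xs $ i)) \<Longrightarrow> form sc ((*s) :: complex \<Rightarrow> complex^'m \<Rightarrow> complex^'m) k \<phi>"
proof (induction k arbitrary: \<phi>)
  case 0
  then show ?case by (simp add: vec_eq_iff)
next
  case (Suc k)
  have "Vector_Spaces.linear sc (*s) (\<lambda>x. \<phi> (x # xs))" for xs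
    using Suc.prems assms by (simp add: Vector_Spaces.linear_iff vec_eq_iff vec.vector_space_axioms)
  then show ?case using Suc by (simp add: vec_eq_iff)
qed

lemma preform_vec:
  assumes "vector_space sc"
  shows "(\<And>i. preform sc (*) k (\<lambda>xs. \<phi> xs $ i)) \<Longrightarrow> preform sc ((*s) :: complex \<Rightarrow> complex^'m \<Rightarrow> complex^'m) k \<phi>"
  using form_vec[OF assms] by (cases k) (auto simp: preform_def fun_eq_iff vec_eq_iff)

text \<open>\<open>M\<close> stands for \<open>\<theta> g\<close>, but any matrix gives a
  representation: \<open>\<eta>\<close> kills brackets, and all the operators are multiples of one
  matrix, so they commute. \<open>V\<close> is the twisted module and \<open>C\<close> the trivial
  one-dimensional module it is compared with.\<close>

locale rank_one_twist =
  fixes sc :: "complex \<Rightarrow> 'h::ab_group_add \<Rightarrow> 'h" and br :: "'h \<Rightarrow> 'h \<Rightarrow> 'h"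
    and \<eta> :: "'h \<Rightarrow> complex" and M :: "complex^'m^'m"
  assumes lie_algebra: "lie_algebra sc br"
    and linear_\<eta>: "Vector_Spaces.linear sc (*) \<eta>"
    and closed_\<eta>: "\<eta> (br x y) = 0"
begin

definition act :: "'h \<Rightarrow> complex^'m \<Rightarrow> complex^'m" where
  "act x v = \<eta> x *s (M *v v)"

sublocale V: lie_module sc br "(*s)" act
proof (rule lie_module.intro)
  fix x y v
  show "lie_algebra sc br" by (rule lie_algebra)
  show "Vector_Spaces.linear (*s) (*s) (act x)"
    by (simp add: Vector_Spaces.linear_iff act_def vec.vector_space_axioms matrix_vector_right_distrib
        vec.scale_right_distrib vec.scale mult.commute)
  show "Vector_Spaces.linear sc (*s) (\<lambda>x. act x v)"
    using linear_\<eta> by (simp add: Vector_Spaces.linear_iff act_def vec.vector_space_axioms vec.scale_left_distrib)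
  show "act (br x y) v = act x (act y v) - act y (act x v)"
    by (simp add: act_def closed_\<eta> vec.scale mult.commute)
qed

sublocale C: lie_module sc br "(*)" "\<lambda>_ _. 0 :: complex"
  by (rule lie_module.intro) (simp_all add: lie_algebra Vector_Spaces.linear_iff V.vs_h
      vector_space_over_itself.vector_space_axioms)

lemma D_eq: "V.D \<phi> xs = cdiff br (\<lambda>_ _. 0) \<phi> xs + M *v wedge1 (*s) \<eta> \<phi> xs"
  by (rule cdiff_eq_wedge1) (simp_all add: act_def)

lemma act_commute: "X ** M = M ** X \<Longrightarrow> X *v act x v = act x (X *v v)"
  by (simp add: act_def vec.scale matrix_vector_mul_assoc)

lemma coboundary_mult: "X ** M = M ** X \<Longrightarrow> V.Coboundary k \<phi> \<Longrightarrow> V.Coboundary k (\<lambda>xs. X *v \<phi> xs)"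
  by (rule coboundary_lin_comp[where f = "(*v) X"]) (simp_all add: act_commute)

lemma cocycle_mult: "X ** M = M ** X \<Longrightarrow> V.Cocycle k \<phi> \<Longrightarrow> V.Cocycle k (\<lambda>xs. X *v \<phi> xs)"
  by (rule cocycle_lin_comp[where f = "(*v) X"]) (simp_all add: act_commute)

text \<open>On twisted cohomology the untwisted Lie derivative along \<open>b\<close> acts as A = -
  \<eta>(b) M, so the relation makes q(A) A^l \<phi> exact. The inverse of q(A) commutes with M and
  hence preserves exactness; dividing by the power of - \<eta>(b) leaves M^l \<phi>.\<close>

lemma coboundary_mpow:
  assumes \<phi>: "V.Cocycle k \<phi>" and "\<eta> b \<noteq> 0"
    and rel: "\<And>xs. (\<Sum>j\<le>K. c j *s ((lie_der br (\<lambda>_ _. 0) b ^^ (l + j)) \<phi> xs)) = 0"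
    and det: "det (mpoly c K (mscale (- \<eta> b) M)) \<noteq> 0"
  shows "V.Coboundary k (\<lambda>xs. mpow M l *v \<phi> xs)"
proof -
  define A where "A = mscale (- \<eta> b) M"
  have AM: "M ** A = A ** M" by (simp add: A_def mscale_mult_left mscale_mult_right)
  have P: "(\<lambda>v. - act b v) = (*v) A"
    by (auto simp: A_def mscale_mult_vec act_def)
  have "act x (act b v) = act b (act x v)" for x v
    by (simp add: act_def vec.scale mult.commute)
  then have "V.Coboundary k (\<lambda>xs. (lie_der br (\<lambda>_ _. 0) b ^^ n) \<phi> xs - mpow A n *v \<phi> xs)" for n
    using V.lie_der_power_cohomologous[OF _ \<phi>, of b n] by (simp add: P mpow_mult_vec)
  then have "V.Coboundary k (\<lambda>xs. \<Sum>j\<le>K. c j *s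
      ((lie_der br (\<lambda>_ _. 0) b ^^ (l + j)) \<phi> xs - mpow A (l + j) *v \<phi> xs))"
    by (intro V.coboundary_sum V.coboundary_scale) simp_all
  moreover have "(\<Sum>j\<le>K. c j *s (mpow A (l + j) *v v)) = mpoly c K A *v (mpow A l *v v)" for v
  proof -
    have "(\<Sum>j\<le>K. mscale (c j) (mpow A (l + j))) *v v = (\<Sum>j\<le>K. mscale (c j) (mpow A (l + j)) *v v)"
      by (simp add: matrix_vector_mult_sum_left)
    then show ?thesis by (simp add: matrix_vector_mul_assoc mpoly_mult_mpow mscale_mult_vec)
  qed
  ultimately have neg: "V.Coboundary k (\<lambda>xs. - (mpoly c K A *v (mpow A l *v \<phi> xs)))"
    using rel by (simp add: vec.scale_right_diff_distrib sum_subtractf)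
  then have cob: "V.Coboundary k (\<lambda>xs. mpoly c K A *v (mpow A l *v \<phi> xs))"
    using V.coboundary_scale[OF neg, of "-1"] by (simp add: vector_space_scale_minus_one[OF vec.vector_space_axioms])
  obtain R where R: "R ** mpoly c K A = mat 1" "\<And>X. X ** mpoly c K A = mpoly c K A ** X \<Longrightarrow> R ** X = X ** R"
    using matrix_inverse_commuting[of "mpoly c K A"] det unfolding A_def by metis
  have "R ** M = M ** R" by (rule R(2)[OF mpoly_commute[OF AM]])
  from coboundary_mult[OF this cob] have "V.Coboundary k (\<lambda>xs. mpow A l *v \<phi> xs)"
    by (simp add: matrix_vector_mul_assoc R(1) matrix_mul_assoc)
  from V.coboundary_scale[OF this, of "1 / (- \<eta> b) ^ l"] show ?thesis
    using \<open>\<eta> b \<noteq> 0\<close> by (simp add: A_def mpow_mscale mscale_mult_vec)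
qed

lemma coboundary_mpow_cancel:
  assumes "det M \<noteq> 0" "V.Coboundary k (\<lambda>xs. mpow M l *v \<phi> xs)"
  shows "V.Coboundary k \<phi>"
proof -
  obtain R where R: "R ** M = mat 1" "M ** R = mat 1"
    using matrix_inverse_commuting[OF assms(1)] by metis
  have "mpow R l ** M = M ** mpow R l"
    using mpow_commute[of M R l] R by simp
  from coboundary_mult[OF this assms(2)] show ?thesis
    by (simp add: matrix_vector_mul_assoc mpow_inverse[OF R])
qed

text \<open>Induction along the kernel filtration of \<open>M\<close>: each layer \<open>ker M\<^sup>a\<^sup>+\<^sup>1 / ker M\<^sup>a\<close> is a trivial
module, and \<open>Q\<close> below lifts its cochains.\<close>
lemma coboundary_of_nilpotent:
  assumes triv: "\<And>\<phi>. C.Cocycle k \<phi> \<Longrightarrow> C.Coboundary k \<phi>"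
  shows "V.Cocycle k \<phi> \<Longrightarrow> (\<And>xs. mpow M a *v \<phi> xs = 0) \<Longrightarrow> V.Coboundary k \<phi>"
proof (induction a arbitrary: \<phi>)
  case 0
  then have "\<phi> = (\<lambda>_. 0)" by auto
  then show ?case using V.coboundary_zero by simp
next
  case (Suc a)
  let ?D0 = "cdiff br (\<lambda>_ _. 0 :: complex^'m)"
  define w where "w xs = mpow M a *v \<phi> xs" for xs
  have Mpow: "mpow M a ** M = M ** mpow M a" by (rule mpow_commute[symmetric]) simp
  have w: "V.Cocycle k w" unfolding w_def by (rule cocycle_mult[OF Mpow Suc.prems(1)])
  have Mw: "M *v w xs = 0" for xs using Suc.prems(2)[of xs] by (simp add: w_def matrix_vector_mul_assoc)
  \<comment> \<open>Since \<open>M\<close> kills \<open>w\<close>, the twist term of the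
    differential vanishes on \<open>w\<close>. So \<open>w\<close> is an untwisted cocycle, and
    triviality can be applied to each coordinate.\<close>
  have "M *v wedge1 (*s) \<eta> w xs = 0" for xs
  proof -
    have "M *v wedge1 (*s) \<eta> w xs = wedge1 (*s) \<eta> (\<lambda>xs. M *v w xs) xs"
      by (rule wedge1_natural) simp
    also have "\<dots> = 0" unfolding Mw by (induction xs) simp_all
    finally show ?thesis .
  qed
  then have "?D0 w xs = 0" for xs
    using w D_eq[of w xs] by (simp add: cocycle_def)
  then have "cocycle sc (*s) br (\<lambda>_ _. 0) k w" using w by (auto simp: cocycle_def)
  then have "C.Cocycle k (\<lambda>xs. w xs $ i)" for i
    by (rule cocycle_lin_comp[OF linear_vec_nth, rotated]) simp
  then have "\<forall>i. \<exists>\<psi>. preform sc (*) k \<psi> \<and> (\<forall>xs. cdiff br (\<lambda>_ _. 0) \<psi> xs = w xs $ i)"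
    using triv unfolding coboundary_def by blast
  then obtain \<psi> where \<psi>: "\<And>i. preform sc (*) k (\<psi> i)" "\<And>i xs. cdiff br (\<lambda>_ _. 0) (\<psi> i) xs = w xs $ i"
    by metis
  define \<Psi> where "\<Psi> xs = (\<chi> i. \<psi> i xs)" for xs
  have \<Psi>: "preform sc (*s) k \<Psi>"
    by (rule preform_vec[OF V.vs_h]) (simp add: \<Psi>_def \<psi>(1))
  have D\<Psi>: "?D0 \<Psi> xs = w xs" for xs
  proof -
    have "?D0 \<Psi> xs $ i = cdiff br (\<lambda>_ _. 0) (\<lambda>xs. \<Psi> xs $ i) xs" for i
      by (rule cdiff_natural[where f = "\<lambda>v. v $ i"]) simp_all
    then show ?thesis by (simp add: vec_eq_iff \<Psi>_def \<psi>(2))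
  qed
  define U where "U = {v. mpow M (Suc a) *v v = 0}"
  have "vec.subspace U"
    unfolding U_def vec.subspace_def by (simp add: matrix_vector_right_distrib vec.scale)
  \<comment> \<open>\<open>Q\<close> is a linear section of \<open>mpow M a\<close> over the image
    of \<open>U\<close>. It need not commute with \<open>M\<close>, but \<open>M *v Q v\<close> lies
    in the kernel of \<open>mpow M a\<close>; so the twist term in \<open>V.D \<Phi>\<close>
    disappears once \<open>mpow M a\<close> is applied.\<close>
  then obtain Q where Q: "range Q \<subseteq> U" "Vector_Spaces.linear (*s) (*s) Q"
    "\<And>v. v \<in> (*v) (mpow M a) ` U \<Longrightarrow> mpow M a *v Q v = v"
    using vec.linear_exists_right_inverse_on[of "(*v) (mpow M a)" U] by auto
  have wU: "w xs \<in> (*v) (mpow M a) ` U" for xs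
    using Suc.prems(2) by (auto simp: w_def U_def)
  define \<Phi> where "\<Phi> xs = Q (\<Psi> xs)" for xs
  have pre: "preform sc (*s) k \<Phi>" unfolding \<Phi>_def by (rule preform_lin_comp[OF Q(2) \<Psi>])
  have "V.D \<Phi> xs = Q (w xs) + M *v Q (wedge1 (*s) \<eta> \<Psi> xs)" for xs
  proof -
    have "Q (?D0 \<Psi> xs) = ?D0 \<Phi> xs" unfolding \<Phi>_def
      by (rule cdiff_natural) (simp_all add: linear_diff[OF Q(2)] linear_zero[OF Q(2)])
    moreover have "Q (wedge1 (*s) \<eta> \<Psi> xs) = wedge1 (*s) \<eta> \<Phi> xs" unfolding \<Phi>_def
      by (rule wedge1_natural[OF Q(2)])
    ultimately show ?thesis using D_eq[of \<Phi> xs] D\<Psi> by simp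
  qed
  moreover have "mpow M a *v (M *v Q v) = 0" for v
    using Q(1) by (auto simp: U_def matrix_vector_mul_assoc Mpow)
  ultimately have "mpow M a *v V.D \<Phi> xs = w xs" for xs
    using Q(3)[OF wU] by (simp add: matrix_vector_right_distrib)
  then have "mpow M a *v (\<phi> xs - V.D \<Phi> xs) = 0" for xs
    by (simp add: w_def matrix_vector_mult_diff_distrib)
  then have "V.Coboundary k (\<lambda>xs. \<phi> xs - V.D \<Phi> xs)"
    by (intro Suc.IH V.cocycle_diff Suc.prems(1) V.cocycle_D pre)
  from V.coboundary_add[OF this V.coboundary_D[OF pre]] show ?case by simp
qed

text \<open>The operator \<open>mpow R l ** mpow M l\<close> from \<open>mpow_stable\<close> splits
  \<open>\<phi>\<close>: its part is exact by assumption, and the remainder is killed by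
  \<open>mpow M n\<close>, where the nilpotent case applies.\<close>

lemma coboundary_of_mpow:
  assumes triv: "\<And>\<phi>. C.Cocycle k \<phi> \<Longrightarrow> C.Coboundary k \<phi>"
    and \<phi>: "V.Cocycle k \<phi>" "V.Coboundary k (\<lambda>xs. mpow M l *v \<phi> xs)"
  shows "V.Coboundary k \<phi>"
proof -
  obtain n R where R: "R ** M = M ** R" "mpow M n = mpow R l ** mpow M l ** mpow M n"
    using mpow_stable[of M] by metis
  have Rl: "mpow R l ** M = M ** mpow R l" using mpow_commute[of M R l] R by simp
  have cob: "V.Coboundary k (\<lambda>xs. mpow R l *v (mpow M l *v \<phi> xs))"
    by (rule coboundary_mult[OF Rl \<phi>(2)])
  have com: "mpow R l ** mpow M l ** M = M ** (mpow R l ** mpow M l)"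
    using Rl mpow_commute[of M M l] by (metis matrix_mul_assoc)
  have "mpow M n *v (\<phi> xs - mpow R l *v (mpow M l *v \<phi> xs)) = 0" for xs
    using R(2) mpow_commute[OF com, of n]
    by (simp add: matrix_vector_mult_diff_distrib matrix_vector_mul_assoc)
  moreover have "V.Cocycle k (\<lambda>xs. \<phi> xs - mpow R l *v (mpow M l *v \<phi> xs))"
    using cocycle_mult[OF com \<phi>(1)] by (intro V.cocycle_diff \<phi>(1)) (simp add: matrix_vector_mul_assoc)
  ultimately have "V.Coboundary k (\<lambda>xs. \<phi> xs - mpow R l *v (mpow M l *v \<phi> xs))"
    using coboundary_of_nilpotent[OF triv] by blast
  from V.coboundary_add[OF this cob] show ?thesis by simp
qed

text \<open>If all twisted cocycles were exact, exactness of \<open>c \<otimes> e\<close> with \<open>e \<in> ker M\<close> would make \<open>c\<close>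
cohomologous to some \<open>\<eta> \<and> \<tau>\<close>; then \<open>(\<eta> \<and> \<tau>) \<otimes> u\<close> is again a cocycle because \<open>\<eta> \<and> \<eta> = 0\<close>, and
pairing with a functional that kills \<open>im M\<close> but not \<open>u\<close> shows that \<open>\<eta> \<and> \<tau>\<close> is exact.\<close>
lemma trivial_coboundary_of_singular:
  assumes exact: "\<And>\<phi>. V.Cocycle k \<phi> \<Longrightarrow> V.Coboundary k \<phi>" and "det M = 0" and c: "C.Cocycle k c"
  shows "C.Coboundary k c"
proof -
  have sing: "\<exists>v. v \<noteq> 0 \<and> N *v v = 0" if "det N = 0" for N :: "complex^'m^'m"
    using that invertible_det_nz[of N] invertible_left_inverse[of N] matrix_left_invertible_ker[of N] by blast
  obtain e where e: "e \<noteq> 0" "M *v e = 0" using sing[OF \<open>det M = 0\<close>] by blast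
  obtain y where y: "y \<noteq> 0" "transpose M *v y = 0" using sing[of "transpose M"] \<open>det M = 0\<close> by auto
  obtain p where p: "e $ p \<noteq> 0" using e(1) by (auto simp: vec_eq_iff)
  obtain q where q: "y $ q \<noteq> 0" using y(1) by (auto simp: vec_eq_iff)
  define \<zeta> where "\<zeta> v = (\<Sum>i\<in>UNIV. y $ i * v $ i)" for v
  define u where "u = axis q (1 / y $ q)"
  have \<zeta>lin: "Vector_Spaces.linear (*s) (*) \<zeta>"
    by (simp add: Vector_Spaces.linear_iff vec.vector_space_axioms vector_space_over_itself.vector_space_axioms
        \<zeta>_def algebra_simps sum.distrib sum_distrib_left)
  have \<zeta>M: "\<zeta> (M *v v) = 0" for v
  proof -
    have "\<zeta> (M *v v) = (\<Sum>j\<in>UNIV. (transpose M *v y) $ j * v $ j)"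
      unfolding \<zeta>_def matrix_vector_mult_def transpose_def vec_lambda_beta sum_distrib_left sum_distrib_right
      by (subst sum.swap) (simp add: mult_ac)
    then show ?thesis using y(2) by simp
  qed
  have "y $ i * u $ i = (if i = q then 1 else 0)" for i using q by (simp add: u_def axis_def)
  then have \<zeta>u: "\<zeta> u = 1" by (simp add: \<zeta>_def)
  have "V.Cocycle k (\<lambda>xs. c xs *s e)"
    by (rule cocycle_lin_comp[OF linear_scale_vec _ c]) (simp add: act_def vec.scale e(2))
  then obtain \<Psi> where \<Psi>: "preform sc (*s) k \<Psi>" "\<And>xs. V.D \<Psi> xs = c xs *s e"
    using exact unfolding coboundary_def by blast
  \<comment> \<open>Normalised so that \<open>\<mu> e = 1\<close>, which recovers \<open>c\<close>
    from c \<otimes> e. As \<open>\<mu>\<close> need not be compatible with \<open>M\<close>, the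
    twist term contributes its own cochain \<open>\<tau>\<close>.\<close>
  define \<mu> where "\<mu> v = v $ p / e $ p" for v :: "complex^'m"
  have \<mu>lin: "Vector_Spaces.linear (*s) (*) \<mu>"
    by (simp add: Vector_Spaces.linear_iff vec.vector_space_axioms vector_space_over_itself.vector_space_axioms
        \<mu>_def add_divide_distrib)
  define \<psi> where "\<psi> xs = \<mu> (\<Psi> xs)" for xs
  define \<tau> where "\<tau> xs = \<mu> (M *v \<Psi> xs)" for xs
  have \<psi>: "preform sc (*) k \<psi>" unfolding \<psi>_def by (rule preform_lin_comp[OF \<mu>lin \<Psi>(1)])
  have dec: "c xs - C.D \<psi> xs = wedge1 (*) \<eta> \<tau> xs" for xs
  proof -
    have "c xs = \<mu> (V.D \<Psi> xs)" using p by (simp add: \<Psi>(2) \<mu>_def)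
    also have "\<dots> = \<mu> (cdiff br (\<lambda>_ _. 0) \<Psi> xs) + \<mu> (M *v wedge1 (*s) \<eta> \<Psi> xs)"
      using \<mu>lin by (simp add: D_eq Vector_Spaces.linear_iff)
    also have "\<mu> (cdiff br (\<lambda>_ _. 0) \<Psi> xs) = C.D \<psi> xs"
      unfolding \<psi>_def by (rule cdiff_natural) (simp_all add: linear_diff[OF \<mu>lin] linear_zero[OF \<mu>lin])
    also have "\<mu> (M *v wedge1 (*s) \<eta> \<Psi> xs) = wedge1 (*) \<eta> \<tau> xs"
      unfolding \<tau>_def
      by (rule wedge1_natural[of "(*s)" "(*)" "\<lambda>v. \<mu> (M *v v)"])
        (rule Vector_Spaces.linear_compose[OF _ \<mu>lin, unfolded comp_def], simp)
    finally show ?thesis by simp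
  qed
  define \<beta> where "\<beta> xs = c xs - C.D \<psi> xs" for xs
  have \<beta>: "C.Cocycle k \<beta>" unfolding \<beta>_def by (intro C.cocycle_diff c C.cocycle_D \<psi>)
  have "\<beta> = wedge1 (*) \<eta> \<tau>" using dec by (auto simp: \<beta>_def)
  then have \<eta>\<beta>: "wedge1 (*) \<eta> \<beta> xs = 0" for xs
    using wedge1_wedge1[OF vector_space_over_itself.vector_space_axioms] by simp
  have "cdiff br (\<lambda>_ _. 0) (\<lambda>xs. \<beta> xs *s u) xs = C.D \<beta> xs *s u" for xs
    by (rule cdiff_natural[symmetric]) (simp_all add: vec.scale_left_diff_distrib)
  moreover have "wedge1 (*s) \<eta> (\<lambda>xs. \<beta> xs *s u) xs = wedge1 (*) \<eta> \<beta> xs *s u" for xs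
    by (rule wedge1_natural[OF linear_scale_vec, symmetric])
  ultimately have "V.Cocycle k (\<lambda>xs. \<beta> xs *s u)"
    using \<beta> form_lin_comp[OF linear_scale_vec, of sc k \<beta> u]
    by (auto simp: cocycle_def D_eq \<eta>\<beta>)
  then have "V.Coboundary k (\<lambda>xs. \<beta> xs *s u)" by (rule exact)
  then have "C.Coboundary k (\<lambda>xs. \<zeta> (\<beta> xs *s u))"
    by (rule coboundary_lin_comp[OF \<zeta>lin, rotated])
      (use \<zeta>lin in \<open>simp add: act_def Vector_Spaces.linear_iff \<zeta>M\<close>)
  then have "C.Coboundary k \<beta>"
    using \<zeta>lin \<zeta>u by (simp add: Vector_Spaces.linear_iff)
  from C.coboundary_add[OF this C.coboundary_D[OF \<psi>]] show ?thesis
    by (simp add: \<beta>_def)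
qed

text \<open>If \<open>M\<close> is invertible, the power of \<open>M\<close> in the assumption can
  be cancelled and everything is exact. If untwisted cohomology vanishes,
  \<open>coboundary_of_mpow\<close> gives exactness. In the remaining case, \<open>M\<close>
  singular and untwisted cohomology nonzero, \<open>trivial_coboundary_of_singular\<close> excludes
  exactness.\<close>

lemma ce_H_nonzero_act_iff:
  assumes "\<And>\<phi>. V.Cocycle k \<phi> \<Longrightarrow> V.Coboundary k (\<lambda>xs. mpow M l *v \<phi> xs)"
  shows "ce_H_nonzero sc (*s) br act k \<longleftrightarrow> lie_H_nonzero sc br k \<and> det M = 0"
  unfolding V.ce_H_nonzero_iff lie_H_nonzero_def C.ce_H_nonzero_iff
  using coboundary_mpow_cancel coboundary_of_mpow trivial_coboundary_of_singular assms by metis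

lemma ce_H_nonzero_act:
  "lie_H_nonzero sc br k \<Longrightarrow> det M = 0 \<Longrightarrow> ce_H_nonzero sc (*s) br act k"
  unfolding V.ce_H_nonzero_iff lie_H_nonzero_def C.ce_H_nonzero_iff
  using trivial_coboundary_of_singular by metis

end

section \<open>Flat \<open>sl\<^sub>2\<close> connections near 0\<close>

lemma form_one_cochain:
  assumes "Vector_Spaces.linear sc sw f" shows "form sc sw (Suc 0) (one_cochain f)"
proof -
  have "Vector_Spaces.linear sc sw (\<lambda>x. one_cochain f (x # xs))" for xs
    using assms by (cases xs) (auto simp: one_cochain_def Vector_Spaces.linear_iff vector_space_scale_zero)
  then show ?thesis by (simp add: one_cochain_def)
qed

lemma lie_module_zero:
  assumes "lie_algebra sc br" "vector_space sw" shows "lie_module sc br sw (\<lambda>_ _. 0)"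
  using assms by (intro lie_module.intro) (auto simp: lie_algebra_def Vector_Spaces.linear_iff vector_space_scale_zero)

lemma ce_d_one_cochain:
  assumes "lie_algebra sc br" and f: "Vector_Spaces.linear sc sw f"
  shows "ce_d sw br (\<lambda>_ _. 0) (one_cochain f) xs = (case xs of [x, y] \<Rightarrow> - f (br x y) | _ \<Rightarrow> 0)"
proof -
  have vs: "vector_space sw" using f by (simp add: Vector_Spaces.linear_iff)
  interpret lie_module sc br sw "\<lambda>_ _. 0" by (rule lie_module_zero[OF assms(1) vs])
  have eq: "ce_d sw br (\<lambda>_ _. 0) (one_cochain f) xs = D (one_cochain f) xs"
    by (rule ce_d_eq_cdiff[OF vs form_one_cochain[OF f]])
  show ?thesis
  proof (cases "length xs = 2")
    case True
    then obtain x y where "xs = [x, y]" by (auto simp: length_Suc_conv numeral_2_eq_2)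
    then show ?thesis unfolding eq by (simp add: one_cochain_def)
  next
    case False
    then have "D (one_cochain f) xs = 0"
      by (intro form_length[OF form_D[OF form_one_cochain[OF f]]]) simp
    with False show ?thesis unfolding eq by (auto split: list.split)
  qed
qed

lemma H1_iff:
  assumes "lie_algebra sc br"
  shows "\<eta> \<in> H1 sc br \<longleftrightarrow> Vector_Spaces.linear sc (*) \<eta> \<and> (\<forall>x y. \<eta> (br x y) = 0)"
  unfolding H1_def
  by (auto simp: ce_d_one_cochain[OF assms] fun_eq_iff split: list.split dest: spec[of _ "[_, _]"])

lemma flat_iff:
  assumes "lie_algebra sc br"
  shows "\<omega> \<in> flat sc br \<longleftrightarrow>
    \<omega> \<in> hom_sl2 sc \<and> (\<forall>x y. \<omega> (br x y) = \<omega> x ** \<omega> y - \<omega> y ** \<omega> x)"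
proof -
  have "(\<lambda>xs. (case xs of [x, y] \<Rightarrow> - \<omega> (br x y) | _ \<Rightarrow> 0) + mc_quad \<omega> xs) = (\<lambda>_. 0) \<longleftrightarrow>
      (\<forall>x y. \<omega> (br x y) = \<omega> x ** \<omega> y - \<omega> y ** \<omega> x)" (is "?f = _ \<longleftrightarrow> ?R")
  proof
    assume "?f = (\<lambda>_. 0)"
    then have "- \<omega> (br x y) + (\<omega> x ** \<omega> y - \<omega> y ** \<omega> x) = 0" for x y
      using fun_cong[of ?f _ "[x, y]"] by (simp add: mc_quad_def)
    then show ?R by (simp add: add_eq_0_iff)
  qed (auto simp: mc_quad_def fun_eq_iff split: list.split)
  then show ?thesis
    unfolding flat_def by (auto simp: hom_sl2_def ce_d_one_cochain[OF assms])
qed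

lemma det_zero: "det (0 :: complex^'n^'n) = 0"
  by (rule det_zero_row(1)[of undefined]) (simp add: row_def vec_eq_iff)

section \<open>Commuting and isotropic elements of sl2\<close>

lemma sl2_iff: "g \<in> sl2 \<longleftrightarrow> g $ 2 $ 2 = - g $ 1 $ 1"
  by (simp add: sl2_def trace_def sum_2 eq_neg_iff_add_eq_0 add.commute)

lemma commutator_eq_zero_iff:
  fixes g h :: "complex^2^2"
  assumes "g \<in> sl2" "h \<in> sl2"
  shows "g ** h = h ** g \<longleftrightarrow> g $ 1 $ 1 * h $ 1 $ 2 = h $ 1 $ 1 * g $ 1 $ 2
     \<and> g $ 1 $ 1 * h $ 2 $ 1 = h $ 1 $ 1 * g $ 2 $ 1 \<and> g $ 1 $ 2 * h $ 2 $ 1 = h $ 1 $ 2 * g $ 2 $ 1"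
  using assms unfolding sl2_iff
  by (simp add: vec_eq_iff forall_2 matrix_matrix_mult_def sum_2) (auto simp: algebra_simps)

text \<open>Two elements of sl2 commute exactly when all 2 by 2 minors of their coordinate vectors
  vanish, so the centraliser of a nonzero element is a line.\<close>

lemma sl2_parallel:
  fixes g h :: "complex^2^2"
  assumes "g \<in> sl2" "h \<in> sl2" "g ** h = h ** g" "g $ i $ j \<noteq> 0"
  shows "h = mscale (h $ i $ j / g $ i $ j) g"
proof -
  have "h $ p $ q * g $ i $ j = h $ i $ j * g $ p $ q" for p q
    using commutator_eq_zero_iff[OF assms(1,2)] assms(1-3) unfolding sl2_iff
    by (cases p rule: exhaust_2[THEN disjE]; cases q rule: exhaust_2[THEN disjE];
        cases i rule: exhaust_2[THEN disjE]; cases j rule: exhaust_2[THEN disjE])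
      (simp_all add: mult.commute)
  then show ?thesis using assms(4) by (simp add: vec_eq_iff mscale_def field_simps)
qed

text \<open>On \<open>sl\<^sub>2\<close> the determinant is a nondegenerate quadratic form in three variables, whose
totally isotropic subspaces are lines.\<close>
lemma sl2_isotropic_commute:
  fixes g h :: "complex^2^2"
  assumes "g \<in> sl2" "h \<in> sl2" "det g = 0" "det h = 0" "det (g + h) = 0"
  shows "g ** h = h ** g"
proof -
  define a b c where "a = g $ 1 $ 1" and "b = g $ 1 $ 2" and "c = g $ 2 $ 1"
  define a' b' c' where "a' = h $ 1 $ 1" and "b' = h $ 1 $ 2" and "c' = h $ 2 $ 1"
  note defs = a_def b_def c_def a'_def b'_def c'_def
  have 22: "g $ 2 $ 2 = - a" "h $ 2 $ 2 = - a'" using assms(1,2) by (simp_all add: sl2_iff defs)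
  have q: "a * - a - b * c = 0" "a' * - a' - b' * c' = 0"
    using assms(3,4) unfolding det_2 22 defs .
  have "(a + a') * (- a + - a') - (b + b') * (c + c') = 0"
    using assms(5) unfolding det_2 vector_add_component 22 defs .
  with q have p: "2 * (a * a') = - (b * c') - b' * c" by algebra
  \<comment> \<open>The minors themselves are not in the ideal of the relations, but their squares
    are: expanding and replacing a^2, a'^2 and 2 a a' by means of \<open>q\<close> and
    \<open>p\<close> cancels everything.\<close>
  have "(a * b' - a' * b)^2 = 0" using p q by algebra
  moreover have "(a * c' - a' * c)^2 = 0" using p q by algebra
  moreover have "(b * c' - b' * c)^2 = 0" using p q by algebra
  ultimately show ?thesis unfolding commutator_eq_zero_iff[OF assms(1,2)]
    by (simp add: a_def b_def c_def a'_def b'_def c'_def)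
qed

text \<open>By Cayley-Hamilton a traceless \<open>g\<close> has scalar square, so 0 = [g^2, z] = g
  [g, z] + [g, z] g.\<close>

lemma sl2_anticommute:
  fixes g z :: "complex^2^2"
  assumes "g \<in> sl2" shows "(g ** z - z ** g) ** g = - (g ** (g ** z - z ** g))"
  using assms unfolding sl2_iff
  by (simp add: vec_eq_iff forall_2 matrix_matrix_mult_def sum_2 algebra_simps)

section \<open>Control by basis values and neighbourhoods of 0\<close>

lemma linear_zero_on_basis:
  assumes "finite_dimensional_vector_space sc B" "Vector_Spaces.linear sc sw f" "\<And>b. b \<in> B \<Longrightarrow> f b = 0"
  shows "f x = 0"
proof -
  interpret finite_dimensional_vector_space sc B by fact
  interpret f: Vector_Spaces.linear sc sw f by fact
  show ?thesis using f.eq_0_on_span[of B x] assms(3) span_Basis by auto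
qed

text \<open>The neighbourhood filter behind \<open>germ0_eq\<close>. Membership in the ambient space
  is put into \<open>P\<close>, so that conditions coming from single basis vectors can be
  intersected by \<open>small_conj\<close> and \<open>small_ball\<close>.\<close>

definition small :: "'h set \<Rightarrow> (('h \<Rightarrow> 'a::real_normed_vector) \<Rightarrow> bool) \<Rightarrow> bool" where
  "small B P \<longleftrightarrow> (\<exists>\<epsilon>>0. \<forall>\<omega>. (\<forall>b\<in>B. norm (\<omega> b) < \<epsilon>) \<longrightarrow> P \<omega>)"

lemma small_mono: "small B P \<Longrightarrow> (\<And>\<omega>. P \<omega> \<Longrightarrow> Q \<omega>) \<Longrightarrow> small B Q"
  unfolding small_def by blast

lemma small_conj: "small B P \<Longrightarrow> small B Q \<Longrightarrow> small B (\<lambda>\<omega>. P \<omega> \<and> Q \<omega>)"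
proof -
  assume "small B P" "small B Q"
  then obtain d e where "d > 0" "\<forall>\<omega>. (\<forall>b\<in>B. norm (\<omega> b) < d) \<longrightarrow> P \<omega>"
    "e > 0" "\<forall>\<omega>. (\<forall>b\<in>B. norm (\<omega> b) < e) \<longrightarrow> Q \<omega>" unfolding small_def by blast
  then show ?thesis unfolding small_def by (intro exI[of _ "min d e"]) simp
qed

lemma small_ball: "finite I \<Longrightarrow> (\<And>i. i \<in> I \<Longrightarrow> small B (P i)) \<Longrightarrow> small B (\<lambda>\<omega>. \<forall>i\<in>I. P i \<omega>)"
proof (induction I rule: finite_induct)
  case empty
  show ?case unfolding small_def by (auto intro: exI[of _ 1])
next
  case (insert i I)
  then show ?case using small_conj[of B "P i" "\<lambda>\<omega>. \<forall>i\<in>I. P i \<omega>"] by simp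
qed

text \<open>The sum is included because \<open>small_flat_commute\<close> tests the connection at
  \<open>b + b'\<close>; half the radius accounts for it.\<close>

lemma small_eventually:
  assumes "\<forall>\<^sub>F g in nhds 0. P g" "b \<in> B" "b' \<in> B"
  shows "small B (\<lambda>\<omega>. P (\<omega> b) \<and> P (\<omega> b + \<omega> b'))"
proof -
  obtain d where d: "d > 0" "\<And>g. norm g < d \<Longrightarrow> P g"
    using assms(1) by (auto simp: eventually_nhds_metric)
  have "norm (\<omega> b + \<omega> b') < d" "norm (\<omega> b) < d" if "\<forall>b\<in>B. norm (\<omega> b) < d / 2" for \<omega>
    using that assms(2,3) norm_triangle_ineq[of "\<omega> b" "\<omega> b'"] d(1) by (smt (verit) field_sum_of_halves)+
  then show ?thesis unfolding small_def using d by (intro exI[of _ "d / 2"]) auto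
qed

lemma germ0_eq_small: "germ0_eq B A X Y \<longleftrightarrow> small B (\<lambda>\<omega>. \<omega> \<in> A \<longrightarrow> (\<omega> \<in> X \<longleftrightarrow> \<omega> \<in> Y))"
  unfolding germ0_eq_def small_def by blast

section \<open>Flat connections near 0 are decomposable\<close>

context
  fixes sc :: "complex \<Rightarrow> 'h::ab_group_add \<Rightarrow> 'h" and br :: "'h \<Rightarrow> 'h \<Rightarrow> 'h" and B :: "'h set"
  assumes fd: "finite_dimensional_vector_space sc B" and lie: "lie_algebra sc br"
begin

lemma finite_basis: "finite B"
  by (rule finite_dimensional_vector_space.finite_Basis[OF fd])

lemma decomposable_flat: "decomposables sc br \<subseteq> flat sc br"
proof
  fix \<omega> assume "\<omega> \<in> decomposables sc br"
  then obtain \<eta> g where \<eta>: "\<eta> \<in> H1 sc br" and g: "g \<in> sl2" and \<omega>: "\<omega> = (\<lambda>x. mscale (\<eta> x) g)"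
    unfolding decomposables_def by blast
  have "\<omega> \<in> hom_sl2 sc"
    using \<eta> g unfolding H1_iff[OF lie] hom_sl2_def \<omega>
    by (auto simp: Vector_Spaces.linear_iff vector_space_mscale sl2_iff mscale_def vec_eq_iff algebra_simps)
  moreover have "\<omega> (br x y) = \<omega> x ** \<omega> y - \<omega> y ** \<omega> x" for x y
    using \<eta> unfolding H1_iff[OF lie] \<omega>
    by (simp add: mscale_mult_left mscale_mult_right mscale_mscale mult.commute)
      (simp add: mscale_def vec_eq_iff)
  ultimately show "\<omega> \<in> flat sc br" by (simp add: flat_iff[OF lie])
qed

lemma flat_decomposable:
  assumes \<omega>: "\<omega> \<in> flat sc br"
    and comm: "\<And>b b' z. b \<in> B \<Longrightarrow> b' \<in> B \<Longrightarrow> det (\<omega> b + \<omega> b') \<noteq> 0 \<Longrightarrow>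
       (\<omega> b + \<omega> b') ** \<omega> z = \<omega> z ** (\<omega> b + \<omega> b')"
  shows "\<omega> \<in> decomposables sc br"
proof -
  have lin: "Vector_Spaces.linear sc mscale \<omega>" and sl2: "\<omega> x \<in> sl2"
    and flat: "\<omega> (br x y) = \<omega> x ** \<omega> y - \<omega> y ** \<omega> x" for x y
    using \<omega> by (auto simp: flat_iff[OF lie] hom_sl2_def)
  have add: "\<omega> (x + y) = \<omega> x + \<omega> y" and scale: "\<omega> (sc c x) = mscale c (\<omega> x)" for x y c
    using lin by (auto simp: Vector_Spaces.linear_iff)
  have vsc: "vector_space sc" using lie by (simp add: lie_algebra_def)
  show ?thesis
  proof (cases "\<omega> = (\<lambda>_. 0)")
    case True
    have "(\<lambda>_. 0) \<in> H1 sc br"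
      by (simp add: H1_iff[OF lie] Vector_Spaces.linear_iff vsc vector_space_over_itself.vector_space_axioms)
    moreover have "0 \<in> sl2" by (simp add: sl2_iff)
    moreover have "\<omega> = (\<lambda>x. mscale 0 0)" unfolding True by (simp add: vector_space_scale_zero[OF vector_space_mscale])
    ultimately show ?thesis unfolding decomposables_def
      by (intro CollectI bexI[of _ "\<lambda>_. 0"] bexI[of _ 0])
  next
    case False
    have "\<exists>x. \<omega> x \<noteq> 0 \<and> (\<forall>z. \<omega> x ** \<omega> z = \<omega> z ** \<omega> x)"
    proof (cases "\<forall>b\<in>B. \<forall>b'\<in>B. det (\<omega> b + \<omega> b') = 0")
      case False
      then obtain b b' where b: "b \<in> B" "b' \<in> B" "det (\<omega> b + \<omega> b') \<noteq> 0" by blast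
      then have "\<omega> (b + b') \<noteq> 0" by (auto simp: add det_zero)
      then show ?thesis using comm[OF b] by (intro exI[of _ "b + b'"]) (simp add: add)
    next
      case True
      \<comment> \<open>The polarisation of det along \<open>\<omega>\<close>. It is bilinear by the
        explicit formula below, so its vanishing on pairs of basis vectors forces it to vanish
        everywhere.\<close>
      define q where "q x y = det (\<omega> x + \<omega> y) - det (\<omega> x) - det (\<omega> y)" for x y
      have q: "q x y = - (2 * \<omega> x $ 1 $ 1 * \<omega> y $ 1 $ 1) - \<omega> x $ 1 $ 2 * \<omega> y $ 2 $ 1 - \<omega> x $ 2 $ 1 * \<omega> y $ 1 $ 2"
        for x y using sl2[of x] sl2[of y] by (simp add: q_def det_2 sl2_iff algebra_simps)
      have linq: "Vector_Spaces.linear sc (*) (q x)" "Vector_Spaces.linear sc (*) (\<lambda>x. q x y)" for x y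
        by (auto simp: q Vector_Spaces.linear_iff vsc vector_space_over_itself.vector_space_axioms
            add scale mscale_def algebra_simps)
      have "q b b' = 0" if "b \<in> B" "b' \<in> B" for b b'
      proof -
        \<comment> \<open>The diagonal pair b = b' supplies the vanishing of det at single basis
          vectors.\<close>
        have "det (\<omega> b + \<omega> b) = 4 * det (\<omega> b)" for b by (simp add: det_2 algebra_simps)
        then have "det (\<omega> b) = 0" if "b \<in> B" for b using True that by force
        then show ?thesis using True that by (simp add: q_def)
      qed
      then have "q b y = 0" if "b \<in> B" for b y
        using linear_zero_on_basis[OF fd linq(1)] that by blast
      then have q0: "q x y = 0" for x y
        using linear_zero_on_basis[OF fd linq(2)] by blast
      have det0: "det (\<omega> x) = 0" for x
        using q0[of x x] unfolding q using sl2[of x] by (simp add: det_2 sl2_iff algebra_simps)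
      have "det (\<omega> x + \<omega> y) = 0" for x y
        using q0[of x y] det0 by (simp add: q_def)
      then have "\<omega> x ** \<omega> z = \<omega> z ** \<omega> x" for x z
        using sl2_isotropic_commute sl2 det0 by blast
      moreover obtain x where "\<omega> x \<noteq> 0" using \<open>\<omega> \<noteq> (\<lambda>_. 0)\<close> by auto
      ultimately show ?thesis by blast
    qed
    then obtain x0 where x0: "\<omega> x0 \<noteq> 0" "\<And>z. \<omega> x0 ** \<omega> z = \<omega> z ** \<omega> x0" by blast
    then obtain i j where ij: "\<omega> x0 $ i $ j \<noteq> 0" by (auto simp: vec_eq_iff)
    define \<eta> where "\<eta> z = \<omega> z $ i $ j / \<omega> x0 $ i $ j" for z
    have eq: "\<omega> z = mscale (\<eta> z) (\<omega> x0)" for z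
      unfolding \<eta>_def by (rule sl2_parallel[OF sl2 sl2 x0(2) ij])
    have "Vector_Spaces.linear sc (*) \<eta>"
      by (simp add: \<eta>_def Vector_Spaces.linear_iff vsc vector_space_over_itself.vector_space_axioms
          add scale mscale_def add_divide_distrib)
    moreover have "\<eta> (br x y) = 0" for x y
    proof -
      have "\<omega> (br x y) = 0"
        unfolding flat eq[of x] eq[of y]
        by (simp add: mscale_mult_left mscale_mult_right mscale_mscale mult.commute)
      then show ?thesis by (simp add: \<eta>_def)
    qed
    ultimately have "\<eta> \<in> H1 sc br" by (simp add: H1_iff[OF lie])
    then show ?thesis unfolding decomposables_def using sl2 eq by blast
  qed
qed

lemma annihilator:
  assumes "vector_space sw"
  shows "\<exists>l K c. c 0 \<noteq> 0 \<and> (\<forall>\<phi> xs. form sc sw k \<phi> \<longrightarrow>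
      (\<Sum>j\<le>K. sw (c j) ((lie_der br (\<lambda>_ _. 0) x ^^ (l + j)) \<phi> xs)) = 0)"
proof -
  interpret fd_trivial_module sc br sw B
    using lie_module_zero[OF lie assms] fd by (intro fd_trivial_module.intro fd_trivial_module_axioms.intro)
  show ?thesis by (rule L_annihilator)
qed

text \<open>By flatness the Lie derivative of \<omega> along x takes the value -
  [\<omega>(x), \<omega>(y)] at y, and this is - 2 \<omega>(x) \<omega>(y) when the two anticommute:
  hence the factor \<open>- 2\<close>. Iteration is possible because \<omega>([x, y]) is a
  commutator with \<omega>(x) and so anticommutes with it by \<open>sl2_anticommute\<close>.\<close>

lemma flat_L_power:
  assumes \<omega>: "\<omega> \<in> flat sc br"
  shows "\<omega> y ** \<omega> x = - (\<omega> x ** \<omega> y) \<Longrightarrow>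
    (lie_der br (\<lambda>_ _. 0) x ^^ n) (one_cochain \<omega>) [y] = mpow (mscale (- 2) (\<omega> x)) n ** \<omega> y"
proof (induction n arbitrary: y)
  case 0
  then show ?case by (simp add: one_cochain_def)
next
  case (Suc n)
  let ?A = "mscale (- 2) (\<omega> x)"
  have flat: "\<omega> (br x y) = \<omega> x ** \<omega> y - \<omega> y ** \<omega> x" and sl2: "\<omega> x \<in> sl2"
    using \<omega> by (auto simp: flat_iff[OF lie] hom_sl2_def)
  have "(lie_der br (\<lambda>_ _. 0) x ^^ Suc n) (one_cochain \<omega>) [y] = - (mpow ?A n ** \<omega> (br x y))"
    using Suc.IH[of "br x y"] sl2_anticommute[OF sl2, of "\<omega> y"] by (simp add: flat)
  also have "\<omega> (br x y) = - (?A ** \<omega> y)"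
    unfolding flat Suc.prems mscale_mult_left by (simp add: mscale_def vec_eq_iff)
  also have "- (mpow ?A n ** - (?A ** \<omega> y)) = mpow ?A n ** ?A ** \<omega> y"
    using mscale_mult_right[of "mpow ?A n" "-1" "?A ** \<omega> y"]
    by (simp add: vector_space_scale_minus_one[OF vector_space_mscale] matrix_mul_assoc)
  also have "mpow ?A n ** ?A = mpow ?A (Suc n)"
    using mpow_commute[of ?A ?A n] by simp
  finally show ?case .
qed

text \<open>The annihilating relation is applied to \<omega> itself as a matrix-valued 1-cochain and
  evaluated at [x, z] for x = b + b'. With A = - 2 \<omega>(x) it reads q(A) A^l W = 0 for the
  commutator W of \<omega>(x) and \<omega>(z). Here q(A) is invertible by smallness and A by the
  determinant condition, so W = 0.\<close>

lemma small_flat_commute: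
  assumes "b \<in> B" "b' \<in> B"
  shows "small B (\<lambda>\<omega>. \<omega> \<in> flat sc br \<longrightarrow> det (\<omega> b + \<omega> b') \<noteq> 0 \<longrightarrow>
    (\<forall>z. (\<omega> b + \<omega> b') ** \<omega> z = \<omega> z ** (\<omega> b + \<omega> b')))"
proof -
  define x where "x = b + b'"
  obtain l K c where c: "c 0 \<noteq> 0" "\<And>\<phi> xs. form sc mscale (Suc 0) \<phi> \<Longrightarrow>
      (\<Sum>j\<le>K. mscale (c j) ((lie_der br (\<lambda>_ _. 0) x ^^ (l + j)) (\<phi> :: 'h list \<Rightarrow> complex^2^2) xs)) = 0"
    using annihilator[OF vector_space_mscale, of "Suc 0" x] by blast
  have "((\<lambda>g :: complex^2^2. mscale (- 2) g) \<longlongrightarrow> mscale (- 2) 0) (nhds 0)"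
    by (intro tendsto_mscale tendsto_const tendsto_ident_at) (simp add: filterlim_ident)
  then have "\<forall>\<^sub>F g in nhds 0. det (mpoly c K (mscale (- 2) g :: complex^2^2)) \<noteq> 0"
    by (intro det_mpoly_nonzero c) (simp add: vector_space_scale_zero[OF vector_space_mscale])
  from small_eventually[OF this assms] show ?thesis
  proof (rule small_mono, intro impI allI)
    fix \<omega> :: "'h \<Rightarrow> complex^2^2" and z
    let ?A = "mscale (- 2) (\<omega> x)"
    assume *: "det (mpoly c K (mscale (- 2) (\<omega> b))) \<noteq> 0 \<and> det (mpoly c K (mscale (- 2) (\<omega> b + \<omega> b'))) \<noteq> 0"
      and \<omega>: "\<omega> \<in> flat sc br" and det: "det (\<omega> b + \<omega> b') \<noteq> 0"
    have lin: "Vector_Spaces.linear sc mscale \<omega>" and sl2: "\<omega> x \<in> sl2"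
      and flat: "\<omega> (br x z) = \<omega> x ** \<omega> z - \<omega> z ** \<omega> x"
      using \<omega> by (auto simp: flat_iff[OF lie] hom_sl2_def)
    have x: "\<omega> x = \<omega> b + \<omega> b'" using lin by (simp add: x_def Vector_Spaces.linear_iff)
    define W where "W = \<omega> (br x z)"
    have "W ** \<omega> x = - (\<omega> x ** W)" unfolding W_def flat by (rule sl2_anticommute[OF sl2])
    then have pow: "(lie_der br (\<lambda>_ _. 0) x ^^ n) (one_cochain \<omega>) [br x z] = mpow ?A n ** W" for n
      unfolding W_def by (rule flat_L_power[OF \<omega>])
    have "(\<Sum>j\<le>K. mscale (c j) (mpow ?A (l + j) ** W)) = 0"
      using c(2)[OF form_one_cochain[OF lin], of "[br x z]"] unfolding pow .
    then have "mpoly c K ?A ** mpow ?A l ** W = 0"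
      by (simp add: mpoly_mult_mpow matrix_mult_sum_left mscale_mult_left)
    moreover have "det (mpoly c K ?A ** mpow ?A l) \<noteq> 0"
    proof -
      have "det (mscale (- 2) X) = 4 * det X" for X :: "complex^2^2"
        by (simp add: det_2 mscale_def algebra_simps)
      then have "det ?A \<noteq> 0" using det by (simp add: x)
      then have "det (mpow ?A l) \<noteq> 0" by (induction l) (simp_all add: det_mul)
      then show ?thesis using * by (simp add: det_mul x)
    qed
    then obtain R where "R ** (mpoly c K ?A ** mpow ?A l) = mat 1"
      using matrix_inverse_commuting by metis
    ultimately have "W = R ** 0" by (metis matrix_mul_assoc matrix_mul_lid)
    then have "W = 0" by (simp add: matrix_matrix_mult_def vec_eq_iff)
    then show "(\<omega> b + \<omega> b') ** \<omega> z = \<omega> z ** (\<omega> b + \<omega> b')"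
      by (simp add: W_def flat x)
  qed
qed

lemma small_flat: "small B (\<lambda>\<omega>. \<omega> \<in> flat sc br \<longleftrightarrow> \<omega> \<in> decomposables sc br)"
proof -
  have "small B (\<lambda>\<omega>. \<forall>b\<in>B. \<forall>b'\<in>B. \<omega> \<in> flat sc br \<longrightarrow> det (\<omega> b + \<omega> b') \<noteq> 0 \<longrightarrow>
      (\<forall>z. (\<omega> b + \<omega> b') ** \<omega> z = \<omega> z ** (\<omega> b + \<omega> b')))"
    by (intro small_ball finite_basis small_flat_commute)
  then show ?thesis
    by (rule small_mono) (use flat_decomposable decomposable_flat in blast)
qed

end

text \<open>\<open>sl2_rep\<close> constrains \<theta> only on \<open>sl2\<close>, so \<theta> may
  be discontinuous as a function of all matrices. \<open>\<Theta>\<close> is the linear map with the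
  same values on the standard basis of sl2, to which continuity arguments apply.\<close>

lemma sl2_rep_tendsto_zero:
  fixes \<theta> :: "complex^2^2 \<Rightarrow> complex^'m^'m"
  assumes "sl2_rep \<theta>"
  obtains \<Theta> :: "complex^2^2 \<Rightarrow> complex^'m^'m"
  where "\<And>g. g \<in> sl2 \<Longrightarrow> \<theta> g = \<Theta> g" "(\<Theta> \<longlongrightarrow> 0) (nhds 0)"
proof
  define unit :: "2 \<Rightarrow> 2 \<Rightarrow> complex^2^2" where "unit p q = (\<chi> i j. if i = p \<and> j = q then 1 else 0)" for p q
  define H where "H = unit 1 1 - unit 2 2"
  define \<Theta> where "\<Theta> g = mscale (g $ 1 $ 1) (\<theta> H) + (mscale (g $ 1 $ 2) (\<theta> (unit 1 2)) + mscale (g $ 2 $ 1) (\<theta> (unit 2 1)))"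
    for g :: "complex^2^2"
  have sl2: "H \<in> sl2" "unit 1 2 \<in> sl2" "unit 2 1 \<in> sl2"
    by (simp_all add: sl2_iff H_def unit_def)
  have closed: "mscale a X \<in> sl2" "X + Y \<in> sl2" if "X \<in> sl2" "Y \<in> sl2" for X Y a
    using that by (simp_all add: sl2_iff mscale_def)
  show "\<theta> g = \<Theta> g" if "g \<in> sl2" for g
  proof -
    have "g = mscale (g $ 1 $ 1) H + (mscale (g $ 1 $ 2) (unit 1 2) + mscale (g $ 2 $ 1) (unit 2 1))"
      using that by (simp add: vec_eq_iff forall_2 sl2_iff mscale_def H_def unit_def)
    then have "\<theta> g = \<theta> (mscale (g $ 1 $ 1) H + (mscale (g $ 1 $ 2) (unit 1 2) + mscale (g $ 2 $ 1) (unit 2 1)))"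
      by simp
    also have "\<dots> = \<Theta> g"
      using assms sl2 closed unfolding sl2_rep_def \<Theta>_def by simp
    finally show ?thesis .
  qed
  have "(\<Theta> \<longlongrightarrow> \<Theta> 0) (nhds 0)" unfolding \<Theta>_def
    by (intro tendsto_add tendsto_mscale tendsto_vec_nth tendsto_const) (simp_all add: filterlim_ident)
  then show "(\<Theta> \<longlongrightarrow> 0) (nhds 0)" by (simp add: \<Theta>_def mscale_def vec_eq_iff flip: zero_vec_def)
qed

section \<open>Resonance near 0\<close>

context
  fixes sc :: "complex \<Rightarrow> 'h::ab_group_add \<Rightarrow> 'h" and br :: "'h \<Rightarrow> 'h \<Rightarrow> 'h" and B :: "'h set"
    and \<theta> :: "complex^2^2 \<Rightarrow> complex^'m^'m"
  assumes fd: "finite_dimensional_vector_space sc B" and lie: "lie_algebra sc br" and rep: "sl2_rep \<theta>"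
begin

lemma theta_scale: "g \<in> sl2 \<Longrightarrow> \<theta> (mscale c g) = mscale c (\<theta> g)"
  using rep by (auto simp: sl2_rep_def)

lemma theta_zero: "\<theta> 0 = 0"
  using theta_scale[of 0 0] by (simp add: sl2_iff mscale_def vec_eq_iff flip: zero_vec_def)

lemma decomposables_det_resonance:
  assumes "lie_H_nonzero sc br k" shows "decomposables_det sc br \<theta> \<subseteq> resonance sc br \<theta> k"
proof
  fix \<omega> assume "\<omega> \<in> decomposables_det sc br \<theta>"
  then obtain \<eta> g where \<eta>: "\<eta> \<in> H1 sc br" and g: "g \<in> sl2" "det (\<theta> g) = 0" and \<omega>: "\<omega> = (\<lambda>x. mscale (\<eta> x) g)"
    unfolding decomposables_det_def by blast
  interpret rank_one_twist sc br \<eta> "\<theta> g"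
    using \<eta> lie by (simp add: rank_one_twist_def H1_iff)
  have "(\<lambda>x v. \<theta> (\<omega> x) *v v) = act"
    by (simp add: act_def \<omega> theta_scale[OF g(1)] mscale_mult_vec fun_eq_iff)
  moreover have "\<omega> \<in> flat sc br"
    using decomposable_flat[OF fd lie] \<eta> g \<omega> unfolding decomposables_def by blast
  ultimately show "\<omega> \<in> resonance sc br \<theta> k"
    using ce_H_nonzero_act[OF assms g(2)] by (simp add: resonance_def)
qed

lemma resonance_decomposables_det:
  assumes small: "\<And>b. b \<in> B \<Longrightarrow> det (mpoly (c b) (K b) (mscale (- 1) (\<theta> (\<omega> b)))) \<noteq> 0"
    and ann: "\<And>b \<phi> xs. b \<in> B \<Longrightarrow> form sc (*s) k \<phi> \<Longrightarrow>
      (\<Sum>j\<le>K b. c b j *s ((lie_der br (\<lambda>_ _. 0) b ^^ (l b + j)) (\<phi> :: 'h list \<Rightarrow> complex^'m) xs)) = 0"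
    and dec: "\<omega> \<in> decomposables sc br" and res: "\<omega> \<in> resonance sc br \<theta> k"
  shows "lie_H_nonzero sc br k \<and> \<omega> \<in> decomposables_det sc br \<theta>"
proof -
  obtain \<eta> g where \<eta>: "\<eta> \<in> H1 sc br" and g: "g \<in> sl2" and \<omega>: "\<omega> = (\<lambda>x. mscale (\<eta> x) g)"
    using dec unfolding decomposables_def by blast
  show ?thesis
  proof (cases "\<exists>b\<in>B. \<eta> b \<noteq> 0")
    case True
    then obtain b where b: "b \<in> B" "\<eta> b \<noteq> 0" by blast
    interpret rank_one_twist sc br \<eta> "\<theta> g"
      using \<eta> lie by (simp add: rank_one_twist_def H1_iff)
    have act: "(\<lambda>x v. \<theta> (\<omega> x) *v v) = act"
      by (simp add: act_def \<omega> theta_scale[OF g(1)] mscale_mult_vec fun_eq_iff)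
    have "V.Coboundary k (\<lambda>xs. mpow (\<theta> g) (l b) *v \<phi> xs)" if "V.Cocycle k \<phi>" for \<phi>
    proof (rule coboundary_mpow[OF that b(2)])
      show "(\<Sum>j\<le>K b. c b j *s ((lie_der br (\<lambda>_ _. 0) b ^^ (l b + j)) \<phi> xs)) = 0" for xs
        by (rule ann[OF b(1) V.cocycle_form[OF that]])
      show "det (mpoly (c b) (K b) (mscale (- \<eta> b) (\<theta> g))) \<noteq> 0"
        using small[OF b(1)] by (simp add: \<omega> theta_scale[OF g(1)] mscale_mscale)
    qed
    from ce_H_nonzero_act_iff[OF this] have "lie_H_nonzero sc br k \<and> det (\<theta> g) = 0"
      using res by (simp add: resonance_def act)
    then show ?thesis using \<eta> g \<omega> unfolding decomposables_det_def by blast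
  next
    case False
    have "\<eta> x = 0" for x
      using linear_zero_on_basis[OF fd, of _ \<eta>] \<eta> False H1_iff[OF lie] by blast
    \<comment> \<open>The given \<open>g\<close> may have invertible image under \<theta>. But the
      zero connection is also \<eta> \<otimes> 0, and the zero matrix is singular because the index
      type of V is nonempty.\<close>
    then have \<omega>0: "\<omega> = (\<lambda>x. 0)" and \<omega>g: "\<omega> = (\<lambda>x. mscale (\<eta> x) 0)"
      by (auto simp: \<omega> mscale_def vec_eq_iff)
    interpret rank_one_twist sc br \<eta> "0 :: complex^'m^'m"
      using \<eta> lie by (simp add: rank_one_twist_def H1_iff)
    have act: "(\<lambda>x v. \<theta> (\<omega> x) *v v) = act"
      by (simp add: act_def \<omega>0 theta_zero fun_eq_iff)
    \<comment> \<open>For M = 0 the exponent 1 already kills every cochain, so the criterion applies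
      without any choice of basis vector.\<close>
    have "V.Coboundary k (\<lambda>xs. mpow 0 1 *v \<phi> xs)" for \<phi>
      using V.coboundary_zero by simp
    from ce_H_nonzero_act_iff[OF this] have "lie_H_nonzero sc br k"
      using res by (simp add: resonance_def act)
    moreover have "\<omega> \<in> decomposables_det sc br \<theta>"
      unfolding decomposables_det_def
    proof (intro CollectI bexI[of _ \<eta>] bexI[of _ 0] conjI)
      show "det (\<theta> 0) = 0" by (simp add: theta_zero det_zero)
      show "0 \<in> sl2" by (simp add: sl2_iff)
    qed (fact \<omega>g \<eta>)+
    ultimately show ?thesis ..
  qed
qed

text \<open>One equivalence serves both halves of the theorem. The relations are chosen for each
  vector before \<omega>, and intersecting over the finite basis gives a single radius; whichever
  basis vector has nonzero \<eta>-value can then be used.\<close>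

lemma small_resonance:
  "small B (\<lambda>\<omega>. \<omega> \<in> hom_sl2 sc \<longrightarrow>
     (\<omega> \<in> resonance sc br \<theta> k \<longleftrightarrow> lie_H_nonzero sc br k \<and> \<omega> \<in> decomposables_det sc br \<theta>))"
proof -
  define ann where "ann b l K c \<longleftrightarrow> (\<forall>\<phi> xs. form sc (*s) k \<phi> \<longrightarrow>
      (\<Sum>j\<le>K. c j *s ((lie_der br (\<lambda>_ _. 0) b ^^ (l + j)) (\<phi> :: 'h list \<Rightarrow> complex^'m) xs)) = 0)"
    for b l K c
  have "\<forall>b. \<exists>l K c. c 0 \<noteq> 0 \<and> ann b l K c"
    unfolding ann_def using annihilator[OF fd lie vec.vector_space_axioms] by (intro allI)
  then obtain l K c where c: "\<And>b. c b 0 \<noteq> 0" and "\<And>b. ann b (l b) (K b) (c b)"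
    by metis
  then have ann: "\<And>b \<phi> xs. form sc (*s) k \<phi> \<Longrightarrow>
      (\<Sum>j\<le>K b. c b j *s ((lie_der br (\<lambda>_ _. 0) b ^^ (l b + j)) (\<phi> :: 'h list \<Rightarrow> complex^'m) xs)) = 0"
    unfolding ann_def by blast
  obtain \<Theta> :: "complex^2^2 \<Rightarrow> complex^'m^'m" where \<Theta>: "\<And>g. g \<in> sl2 \<Longrightarrow> \<theta> g = \<Theta> g" "(\<Theta> \<longlongrightarrow> 0) (nhds 0)"
    using sl2_rep_tendsto_zero[OF rep] by blast
  have "((\<lambda>g. mscale (- 1) (\<Theta> g)) \<longlongrightarrow> mscale (- 1) 0) (nhds 0)"
    by (intro tendsto_mscale tendsto_const \<Theta>)
  then have ev: "\<forall>\<^sub>F g in nhds 0. det (mpoly (c b) (K b) (mscale (- 1) (\<Theta> g))) \<noteq> 0" for b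
    by (intro det_mpoly_nonzero c) (simp add: vector_space_scale_zero[OF vector_space_mscale])
  have "small B (\<lambda>\<omega>. \<forall>b\<in>B. det (mpoly (c b) (K b) (mscale (- 1) (\<Theta> (\<omega> b)))) \<noteq> 0)"
  proof (rule small_ball[OF finite_basis[OF fd lie]])
    fix b assume b: "b \<in> B"
    show "small B (\<lambda>\<omega>. det (mpoly (c b) (K b) (mscale (- 1) (\<Theta> (\<omega> b)))) \<noteq> 0)"
      by (rule small_mono[OF small_eventually[OF ev[of b] b b]]) (rule conjunct1)
  qed
  from small_conj[OF this small_flat[OF fd lie]] show ?thesis
  proof (rule small_mono, intro impI)
    fix \<omega> :: "'h \<Rightarrow> complex^2^2"
    assume *: "(\<forall>b\<in>B. det (mpoly (c b) (K b) (mscale (- 1) (\<Theta> (\<omega> b)))) \<noteq> 0) \<and>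
       (\<omega> \<in> flat sc br \<longleftrightarrow> \<omega> \<in> decomposables sc br)" and "\<omega> \<in> hom_sl2 sc"
    then have small: "det (mpoly (c b) (K b) (mscale (- 1) (\<theta> (\<omega> b)))) \<noteq> 0" if "b \<in> B" for b
      using that by (simp add: \<Theta>(1) hom_sl2_def)
    have "\<omega> \<in> decomposables sc br" if "\<omega> \<in> resonance sc br \<theta> k"
      using * that by (auto simp: resonance_def)
    with resonance_decomposables_det[OF small ann] decomposables_det_resonance
    show "\<omega> \<in> resonance sc br \<theta> k \<longleftrightarrow> lie_H_nonzero sc br k \<and> \<omega> \<in> decomposables_det sc br \<theta>"
      by blast
  qed
qed

end

text \<open>With trivial coefficients the differential vanishes in degree 0, so zero is the only
  exact 1-cochain and every closed one represents its own class.\<close>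

lemma H1_eq_zero:
  assumes "lie_algebra sc br" "\<not> lie_H_nonzero sc br 1"
  shows "H1 sc br = {\<lambda>_. 0}"
proof -
  have vsc: "vector_space sc" using assms(1) by (simp add: lie_algebra_def)
  interpret C: lie_module sc br "(*)" "\<lambda>_ _. 0 :: complex"
    by (rule lie_module_zero[OF assms(1) vector_space_over_itself.vector_space_axioms])
  have "\<eta> = (\<lambda>_. 0)" if \<eta>: "\<eta> \<in> H1 sc br" for \<eta>
  proof -
    have lin: "Vector_Spaces.linear sc (*) \<eta>" using \<eta> by (simp add: H1_def)
    have "ce_d (*) br (\<lambda>_ _. 0) (one_cochain \<eta>) = (\<lambda>_. 0)" using \<eta> by (simp add: H1_def)
    then have "C.Cocycle 1 (one_cochain \<eta>)"
      using form_one_cochain[OF lin] ce_d_eq_cdiff[OF C.vs_w form_one_cochain[OF lin], of br "\<lambda>_ _. 0"]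
      by (simp add: cocycle_def fun_eq_iff del: form.simps)
    then have "C.Coboundary 1 (one_cochain \<eta>)"
      using assms(2) by (auto simp: lie_H_nonzero_def C.ce_H_nonzero_iff)
    then obtain \<psi> where "form sc (*) 0 \<psi>" "\<And>xs. C.D \<psi> xs = one_cochain \<eta> xs"
      by (auto simp: coboundary_def preform_def)
    from this(2)[of "[_]"] show ?thesis by (auto simp: one_cochain_def)
  qed
  moreover have "(\<lambda>_. 0) \<in> H1 sc br"
    by (simp add: H1_iff[OF assms(1)] Vector_Spaces.linear_iff vsc vector_space_over_itself.vector_space_axioms)
  ultimately show ?thesis by blast
qed

theorem theorem4p7:
  fixes sc :: "complex \<Rightarrow> 'h::ab_group_add \<Rightarrow> 'h" and br :: "'h \<Rightarrow> 'h \<Rightarrow> 'h"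
    and B :: "'h set" and \<theta> :: "complex^2^2 \<Rightarrow> complex^'m^'m"
  assumes "finite_dimensional_vector_space sc B"
    and "lie_algebra sc br"
    and "sl2_rep \<theta>"
  shows "(\<not> lie_H_nonzero sc br 1 \<longrightarrow>
            germ0_eq B (hom_sl2 sc) (flat sc br) {\<lambda>_. 0} \<and>
            (\<forall>i. (\<not> lie_H_nonzero sc br i \<longrightarrow> germ0_eq B (hom_sl2 sc) (resonance sc br \<theta> i) {}) \<and>
                 (lie_H_nonzero sc br i \<longrightarrow> germ0_eq B (hom_sl2 sc) (resonance sc br \<theta> i) {\<lambda>_. 0})))
       \<and> (lie_H_nonzero sc br 1 \<longrightarrow>
            germ0_eq B (hom_sl2 sc) (flat sc br) (decomposables sc br) \<and>
            (\<forall>i. (\<not> lie_H_nonzero sc br i \<longrightarrow> germ0_eq B (hom_sl2 sc) (resonance sc br \<theta> i) {}) \<and>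
                 (lie_H_nonzero sc br i \<longrightarrow>
                    germ0_eq B (hom_sl2 sc) (resonance sc br \<theta> i) (decomposables_det sc br \<theta>))))"
proof -
  \<comment> \<open>When there are no nonzero closed 1-forms both cones collapse to the origin, so
    the first half of the theorem is read off from the same germ equalities as the second.\<close>
  have zero: "decomposables sc br = {\<lambda>_. 0}" "decomposables_det sc br \<theta> = {\<lambda>_. 0}" if "\<not> lie_H_nonzero sc br 1"
  proof -
    have m: "mscale 0 g = 0" for g :: "complex^2^2" by (simp add: mscale_def vec_eq_iff)
    have s: "0 \<in> sl2" "det (\<theta> 0) = 0" using theta_zero[OF assms] by (simp_all add: sl2_iff det_zero)
    show "decomposables sc br = {\<lambda>_. 0}" "decomposables_det sc br \<theta> = {\<lambda>_. 0}"
      unfolding decomposables_def decomposables_det_def H1_eq_zero[OF assms(2) that] using s by (auto simp: m)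
  qed
  have flat: "germ0_eq B (hom_sl2 sc) (flat sc br) (decomposables sc br)"
    unfolding germ0_eq_small by (rule small_mono[OF small_flat[OF assms(1,2)]]) blast
  have res0: "germ0_eq B (hom_sl2 sc) (resonance sc br \<theta> i) {}" if "\<not> lie_H_nonzero sc br i" for i
    unfolding germ0_eq_small by (rule small_mono[OF small_resonance[OF assms, of i]]) (use that in blast)
  have res: "germ0_eq B (hom_sl2 sc) (resonance sc br \<theta> i) (decomposables_det sc br \<theta>)"
    if "lie_H_nonzero sc br i" for i
    unfolding germ0_eq_small by (rule small_mono[OF small_resonance[OF assms, of i]]) (use that in blast)
  show ?thesis using flat res0 res zero by auto
qed

end
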